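(* Let $\mathcal{H}$ be a complex Hilbert space and let $T\in\mathcal{B}(\mathcal{H})$ be such that there exists $\lambda\in\partial\sigma(T)$ which is not an eigenvalue of $T$. Then for any $\varepsilon>0$ there exists a decomposition $\mathcal{H}=Y\oplus Y^{\perp}$ into infinite-dimensional closed subspaces such that the corresponding matrix representation of $T$ has the form $$T=\begin{bmatrix} \lambda I+K & * \\ F & * \end{bmatrix},$$ where $K:Y\to Y$ is compact, $F:Y\to Y^\perp$ has rank one, and $\|K\|\le\varepsilon$, $\|F\|\le\varepsilon$. Moreover, after applying a similarity one can obtain that $K$ is diagonal with respect to an orthonormal basis; that is, for any $\varepsilon>0$ there is a bounded invertible operator $S\in\mathcal{B}(\mathcal{H})$ such that $STS^{-1}$ has a matrix representation of the form $$STS^{-1}=\begin{bmatrix} \lambda I+K & * \\ F & * \end{bmatrix}$$ (with respect to some decomposition $\mathcal{H}=Y\oplus Y^\perp$ into infinite-dimensional closed subspaces, with $K:Y\to Y$ compact, $F:Y\to Y^\perp$ of rank one, and $\|K\|,\|F\|\le\varepsilon$) in which $K$ is diagonal with respect to an orthonormal basis of $Y$.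
   Context: $\mathcal{B}(\mathcal{H})$ is the algebra of bounded linear operators on $\mathcal{H}$; $\sigma(T)$ is the spectrum of $T$ and $\partial\sigma(T)$ its topological boundary in $\mathbb{C}$. Entries denoted $*$ are unspecified bounded operators. *)

theory Defs
  imports "HOL-Analysis.Analysis"
begin

section \<open>Complex Hilbert spaces\<close>

class complex_vector = real_vector +
  fixes scaleC :: "complex \<Rightarrow> 'a \<Rightarrow> 'a" (infixr \<open>*\<^sub>C\<close> 75)
  assumes scaleC_add_right: "c *\<^sub>C (x + y) = c *\<^sub>C x + c *\<^sub>C y"
    and scaleC_add_left: "(c + d) *\<^sub>C x = c *\<^sub>C x + d *\<^sub>C x"
    and scaleC_scaleC: "c *\<^sub>C d *\<^sub>C x = (c * d) *\<^sub>C x"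
    and scaleC_one: "1 *\<^sub>C x = x"
    and scaleR_scaleC: "r *\<^sub>R x = complex_of_real r *\<^sub>C x"

global_interpretation complex_vector:
  vector_space "scaleC :: complex \<Rightarrow> 'a \<Rightarrow> 'a::complex_vector"
  defines csubspace = complex_vector.subspace
    and cspan = complex_vector.span
    and cdependent = complex_vector.dependent
    and cdim = complex_vector.dim
  by unfold_locales (simp_all add: scaleC_add_right scaleC_add_left scaleC_scaleC scaleC_one)

text \<open>The inner product is linear in its first argument. Positive definiteness
  follows from \<open>cinner_self\<close>, which ties the inner product to the norm.\<close>

class complex_inner = complex_vector + real_normed_vector +
  fixes cinner :: "'a \<Rightarrow> 'a \<Rightarrow> complex"
  assumes cinner_commute: "cinner x y = cnj (cinner y x)"
    and cinner_add_left: "cinner (x + y) z = cinner x z + cinner y z"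
    and cinner_scaleC_left: "cinner (c *\<^sub>C x) y = c * cinner x y"
    and cinner_self: "cinner x x = complex_of_real ((norm x)\<^sup>2)"

class chilbert_space = complex_inner + complete_space

instance chilbert_space \<subseteq> banach ..

definition infinite_cdim :: "'a::complex_vector set \<Rightarrow> bool" where
  "infinite_cdim U \<longleftrightarrow> \<not> (\<exists>B. finite B \<and> U \<subseteq> cspan B)"

definition orth_compl :: "'a::complex_inner set \<Rightarrow> 'a set" where
  "orth_compl Y = {z. \<forall>y\<in>Y. cinner z y = 0}"

definition orthonormal_basis_of :: "'a::complex_inner set \<Rightarrow> 'a set \<Rightarrow> bool" where
  "orthonormal_basis_of Y E \<longleftrightarrow>
     (\<forall>e\<in>E. \<forall>f\<in>E. cinner e f = (if e = f then 1 else 0)) \<and> closure (cspan E) = Y"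


section \<open>Bounded operators\<close>

text \<open>An operator between subspaces \<open>U\<close> and \<open>V\<close> is a function on the whole space of which
  only the values on \<open>U\<close> matter.\<close>

definition bounded_op :: "'a::complex_inner set \<Rightarrow> 'a set \<Rightarrow> ('a \<Rightarrow> 'a) \<Rightarrow> bool" where
  "bounded_op U V A \<longleftrightarrow>
     (\<forall>x\<in>U. A x \<in> V) \<and>
     (\<forall>x\<in>U. \<forall>y\<in>U. A (x + y) = A x + A y) \<and>
     (\<forall>c. \<forall>x\<in>U. A (c *\<^sub>C x) = c *\<^sub>C A x) \<and>
     (\<exists>M. \<forall>x\<in>U. norm (A x) \<le> M * norm x)"

lemma bounded_op_UNIV_iff:
  "bounded_op UNIV UNIV A \<longleftrightarrow> bounded_linear A \<and> (\<forall>c x. A (c *\<^sub>C x) = c *\<^sub>C A x)"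
  unfolding bounded_op_def bounded_linear_def bounded_linear_axioms_def linear_iff
  by (auto simp: scaleR_scaleC mult.commute)

definition opnorm :: "'a::complex_inner set \<Rightarrow> ('a \<Rightarrow> 'a) \<Rightarrow> real" where
  "opnorm U A = (SUP x\<in>{x\<in>U. norm x \<le> 1}. norm (A x))"

definition compact_op :: "'a::complex_inner set \<Rightarrow> 'a set \<Rightarrow> ('a \<Rightarrow> 'a) \<Rightarrow> bool" where
  "compact_op U V A \<longleftrightarrow> bounded_op U V A \<and> compact (closure (A ` {x\<in>U. norm x \<le> 1}))"

text \<open>\<open>cdim\<close> is \<open>0\<close> on infinite-dimensional sets, so value \<open>1\<close> means exactly
  one-dimensional range.\<close>

definition rank_one_op :: "'a::complex_inner set \<Rightarrow> 'a set \<Rightarrow> ('a \<Rightarrow> 'a) \<Rightarrow> bool" where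
  "rank_one_op U V A \<longleftrightarrow> bounded_op U V A \<and> cdim (A ` U) = 1"

definition diagonal_op :: "'a::complex_inner set \<Rightarrow> ('a \<Rightarrow> 'a) \<Rightarrow> bool" where
  "diagonal_op Y A \<longleftrightarrow> (\<exists>E. orthonormal_basis_of Y E \<and> (\<forall>e\<in>E. \<exists>c. A e = c *\<^sub>C e))"

definition invertible_op :: "('a::complex_inner \<Rightarrow> 'a) \<Rightarrow> bool" where
  "invertible_op A \<longleftrightarrow> bounded_op UNIV UNIV A \<and>
     (\<exists>B. bounded_op UNIV UNIV B \<and> A \<circ> B = id \<and> B \<circ> A = id)"

definition op_spectrum :: "('a::complex_inner \<Rightarrow> 'a) \<Rightarrow> complex set" where
  "op_spectrum T = {c. \<not> invertible_op (\<lambda>x. T x - c *\<^sub>C x)}"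

definition op_eigenvalue :: "('a::complex_inner \<Rightarrow> 'a) \<Rightarrow> complex \<Rightarrow> bool" where
  "op_eigenvalue T c \<longleftrightarrow> (\<exists>x. x \<noteq> 0 \<and> T x = c *\<^sub>C x)"


section \<open>Block matrices\<close>

definition orth_decomposition :: "'a::complex_inner set \<Rightarrow> bool" where
  "orth_decomposition Y \<longleftrightarrow>
     csubspace Y \<and> closed Y \<and> csubspace (orth_compl Y) \<and> closed (orth_compl Y) \<and>
     (\<forall>x. \<exists>y\<in>Y. \<exists>z\<in>orth_compl Y. x = y + z)"

text \<open>\<open>T\<close> is represented by the matrix with rows \<open>(A, B)\<close> and \<open>(C, D)\<close> relative to
  \<open>Y\<close> and its orthogonal complement.\<close>

definition block_matrix ::
  "'a::complex_inner set \<Rightarrow> ('a \<Rightarrow> 'a) \<Rightarrow> ('a \<Rightarrow> 'a) \<Rightarrow> ('a \<Rightarrow> 'a) \<Rightarrow> ('a \<Rightarrow> 'a) \<Rightarrow> ('a \<Rightarrow> 'a) \<Rightarrow> bool" where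
  "block_matrix Y T A B C D \<longleftrightarrow>
     bounded_op Y Y A \<and> bounded_op (orth_compl Y) Y B \<and>
     bounded_op Y (orth_compl Y) C \<and> bounded_op (orth_compl Y) (orth_compl Y) D \<and>
     (\<forall>y\<in>Y. \<forall>z\<in>orth_compl Y. T (y + z) = (A y + B z) + (C y + D z))"

end

theory Submission
  imports Defs
begin

text \<open>Since \<open>l\<close> is a boundary point of the spectrum, the resolvent blows up along some sequence tending
  to \<open>l\<close>, and by uniform boundedness it does so on a single unit vector \<open>e\<close>. Normalizing gives unit
  vectors with \<open>T x\<^sub>n = l x\<^sub>n + \<nu>\<^sub>n x\<^sub>n + \<alpha>\<^sub>n e\<close>, where \<open>\<nu>\<^sub>n \<rightarrow> 0\<close> and \<open>0 < \<alpha>\<^sub>n \<rightarrow> 0\<close>. As \<open>l\<close> is not an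
  eigenvalue, \<open>x\<^sub>n\<close> tends weakly to \<open>0\<close>, so a subsequence is summably close to an orthonormal sequence
  \<open>u\<^sub>k\<close> orthogonal to \<open>e\<close>. Let \<open>v\<^sub>k\<close> and \<open>w\<^sub>k\<close> be the terms of even and odd index. An operator \<open>R\<close> close
  to the identity maps \<open>v\<^sub>k\<close> to the corresponding \<open>x\<^sub>n\<close> and fixes \<open>e\<close> and all \<open>w\<^sub>k\<close>. For \<open>T\<close> itself take
  for \<open>Y\<close> the closed span of these \<open>x\<^sub>n\<close>; the \<open>w\<^sub>k\<close> show that it has infinite codimension. With
  \<open>S = R\<^sup>-\<^sup>1\<close> we have \<open>S T S\<^sup>-\<^sup>1 v\<^sub>k = l v\<^sub>k + \<nu> v\<^sub>k + \<alpha> e\<close>; now \<open>Y\<close> is the closed span of the \<open>v\<^sub>k\<close>, and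
  since \<open>e\<close> is orthogonal to it, \<open>K\<close> is diagonal.\<close>

section \<open>Inner products\<close>

lemma cinner_add_right: "cinner x (y + z) = cinner x y + cinner x z"
  by (metis cinner_add_left cinner_commute complex_cnj_add)

lemma cinner_scaleC_right: "cinner x (c *\<^sub>C y) = cnj c * cinner x y"
  by (metis cinner_scaleC_left cinner_commute complex_cnj_mult)

lemma cinner_zero_left [simp]: "cinner 0 x = 0"
  using cinner_add_left[of 0 0 x] by simp

lemma cinner_zero_right [simp]: "cinner x 0 = 0"
  using cinner_add_right[of x 0 0] by simp

lemma cinner_minus_left: "cinner (- x) y = - cinner x y"
  using cinner_add_left[of x "- x" y] by (simp add: eq_neg_iff_add_eq_0 add.commute)

lemma cinner_minus_right: "cinner x (- y) = - cinner x y"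
  using cinner_add_right[of x y "- y"] by (simp add: eq_neg_iff_add_eq_0 add.commute)

lemma cinner_diff_left: "cinner (x - y) z = cinner x z - cinner y z"
  using cinner_add_left[of x "- y" z] by (simp add: cinner_minus_left)

lemma cinner_diff_right: "cinner x (y - z) = cinner x y - cinner x z"
  using cinner_add_right[of x y "- z"] by (simp add: cinner_minus_right)

lemma cinner_sum_left: "cinner (sum f A) y = (\<Sum>i\<in>A. cinner (f i) y)"
  by (induction A rule: infinite_finite_induct) (auto simp: cinner_add_left)

lemmas cinner_simps =
  cinner_add_left cinner_add_right cinner_diff_left cinner_diff_right
  cinner_minus_left cinner_minus_right cinner_scaleC_left cinner_scaleC_right

lemma cinner_eq_zero_sym: "cinner x y = 0 \<longleftrightarrow> cinner y x = 0"
  by (metis cinner_commute complex_cnj_zero)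

lemma cinner_self_eq_zero [simp]: "cinner x x = 0 \<longleftrightarrow> x = 0"
  by (simp add: cinner_self)

lemma norm_eq_1_if_cinner_self:
  assumes "cinner x x = 1"
  shows "norm (x::'a::complex_inner) = 1"
proof -
  have "complex_of_real ((norm x)\<^sup>2) = 1"
    using assms by (simp only: cinner_self)
  then have "(norm x)\<^sup>2 = 1\<^sup>2"
    by (simp only: of_real_eq_1_iff) simp
  then show ?thesis
    by (rule power2_eq_imp_eq) simp_all
qed

lemma norm_scaleC [simp]: "norm (c *\<^sub>C x) = cmod c * norm (x::'a::complex_inner)"
proof -
  have "complex_of_real ((norm (c *\<^sub>C x))\<^sup>2) = c * cnj c * cinner x x"
    unfolding cinner_self[symmetric] by (simp add: cinner_simps)
  also have "\<dots> = complex_of_real ((cmod c * norm x)\<^sup>2)"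
    by (simp only: complex_norm_square[symmetric] cinner_self) (simp add: power_mult_distrib)
  finally have "(norm (c *\<^sub>C x))\<^sup>2 = (cmod c * norm x)\<^sup>2"
    unfolding of_real_eq_iff .
  then show ?thesis
    by (simp add: power2_eq_iff_nonneg)
qed

lemma bounded_linear_scaleC_left: "bounded_linear (\<lambda>c. c *\<^sub>C (x::'a::complex_inner))"
  by (rule bounded_linear_intro[where K = "norm x"])
     (auto simp: scaleC_add_left scaleR_scaleC scaleC_scaleC scaleR_conv_of_real)

lemma bounded_linear_scaleC_right: "bounded_linear (\<lambda>x::'a::complex_inner. c *\<^sub>C x)"
  by (rule bounded_linear_intro[where K = "cmod c"])
     (auto simp: scaleC_add_right scaleR_scaleC scaleC_scaleC mult.commute)

lemma norm_diff_squared: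
  "(norm (x - y))\<^sup>2 = (norm x)\<^sup>2 - 2 * Re (cinner x y) + (norm (y::'a::complex_inner))\<^sup>2"
proof -
  have "complex_of_real ((norm (x - y))\<^sup>2)
      = of_real ((norm x)\<^sup>2) - (cinner x y + cnj (cinner x y)) + of_real ((norm y)\<^sup>2)"
    unfolding cinner_self[symmetric] cinner_commute[symmetric] by (simp add: cinner_simps)
  also have "\<dots> = of_real ((norm x)\<^sup>2 - 2 * Re (cinner x y) + (norm y)\<^sup>2)"
    by (simp add: complex_add_cnj)
  finally show ?thesis
    unfolding of_real_eq_iff .
qed

lemma norm_add_squared_orthogonal:
  "cinner x y = 0 \<Longrightarrow> (norm (x + y))\<^sup>2 = (norm x)\<^sup>2 + (norm (y::'a::complex_inner))\<^sup>2"
  using norm_diff_squared[of x "- y"] by (simp add: cinner_minus_right)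

lemma parallelogram:
  "(norm (x - y))\<^sup>2 + (norm (x + y))\<^sup>2 = 2 * (norm x)\<^sup>2 + 2 * (norm (y::'a::complex_inner))\<^sup>2"
  using norm_diff_squared[of x y] norm_diff_squared[of x "- y"] by (simp add: cinner_minus_right)

text \<open>The coefficient is that of the orthogonal projection of \<open>x\<close> onto the line
  through \<open>z\<close>, so this is Pythagoras. It yields both Cauchy-Schwarz and the
  orthogonality of a best approximation.\<close>

lemma norm_minus_component_squared:
  assumes "z \<noteq> (0::'a::complex_inner)"
  shows "(norm (x - (cinner x z / of_real ((norm z)\<^sup>2)) *\<^sub>C z))\<^sup>2
    = (norm x)\<^sup>2 - (cmod (cinner x z))\<^sup>2 / (norm z)\<^sup>2"
proof -
  have "Re (cinner x ((cinner x z / of_real ((norm z)\<^sup>2)) *\<^sub>C z)) = (cmod (cinner x z))\<^sup>2 / (norm z)\<^sup>2"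
  proof -
    have "cinner x ((cinner x z / of_real ((norm z)\<^sup>2)) *\<^sub>C z)
        = (cinner x z * cnj (cinner x z)) / of_real ((norm z)\<^sup>2)"
      by (simp add: cinner_scaleC_right)
    also have "\<dots> = of_real ((cmod (cinner x z))\<^sup>2 / (norm z)\<^sup>2)"
      by (simp only: complex_norm_square[symmetric] of_real_divide)
    finally show ?thesis
      by simp
  qed
  moreover have "cmod (cinner x z / of_real ((norm z)\<^sup>2)) * norm z = cmod (cinner x z) / norm z"
    using assms by (simp only: norm_divide norm_of_real) (simp add: power2_eq_square)
  ultimately show ?thesis
    unfolding norm_diff_squared[of x] norm_scaleC by (simp add: power_divide)
qed

lemma norm_cinner_le: "cmod (cinner x y) \<le> norm x * norm (y::'a::complex_inner)"
proof (cases "y = 0")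
  case False
  have "(cmod (cinner x y))\<^sup>2 / (norm y)\<^sup>2 \<le> (norm x)\<^sup>2"
    using norm_minus_component_squared[OF False, of x]
    by (metis diff_ge_0_iff_ge zero_le_power2)
  then have "(cmod (cinner x y))\<^sup>2 \<le> (norm x * norm y)\<^sup>2"
    using False by (simp add: divide_le_eq power_mult_distrib)
  then show ?thesis
    by (rule power2_le_imp_le) simp
qed simp

lemma bounded_linear_cinner_left: "bounded_linear (\<lambda>x. cinner x (y::'a::complex_inner))"
  by (rule bounded_linear_intro[where K = "norm y"])
     (auto simp: cinner_add_left scaleR_scaleC cinner_scaleC_left scaleR_conv_of_real norm_cinner_le)

lemma closed_cinner_eq_zero: "closed {x. cinner x (y::'a::complex_inner) = 0}"
  by (intro closed_Collect_eq continuous_intros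
      bounded_linear.continuous_on[OF bounded_linear_cinner_left] continuous_on_id)

lemma csubspace_cinner_eq_zero: "csubspace {x. cinner x (y::'a::complex_inner) = 0}"
  by (auto simp: complex_vector.subspace_def cinner_simps)

lemma closed_orth_compl: "closed (orth_compl Y)"
proof -
  have "orth_compl Y = (\<Inter>y\<in>Y. {z. cinner z y = 0})"
    by (auto simp: orth_compl_def)
  then show ?thesis
    by (simp add: closed_INT closed_cinner_eq_zero)
qed

lemma csubspace_orth_compl: "csubspace (orth_compl Y)"
  by (auto simp: orth_compl_def complex_vector.subspace_def cinner_simps)

section \<open>Orthogonal projections\<close>

text \<open>A sequence in \<open>Y\<close> minimizing the distance to \<open>x\<close> is Cauchy by
  the parallelogram law. Its limit is a nearest point, and minimality makes the residual orthogonal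
  to \<open>Y\<close>.\<close>

lemma orthogonal_projection_exists:
  fixes Y :: "'a::chilbert_space set"
  assumes sub: "csubspace Y" and cl: "closed Y"
  shows "\<exists>y\<in>Y. x - y \<in> orth_compl Y"
proof -
  have ne: "Y \<noteq> {}" using complex_vector.subspace_0[OF sub] by auto
  define d where "d = infdist x Y"
  have d_le: "d \<le> norm (x - y)" if "y \<in> Y" for y
    using infdist_le[OF that, of x] by (simp add: d_def dist_norm)
  have d0: "d \<ge> 0" by (simp add: d_def infdist_nonneg)
  have "\<exists>y\<in>Y. norm (x - y) < d + inverse (Suc n)" for n
  proof -
    have "d < d + inverse (Suc n)" by simp
    then have "(INF y\<in>Y. dist x y) < d + inverse (Suc n)"
      by (simp add: d_def infdist_notempty[OF ne])
    then show ?thesis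
      by (subst (asm) cINF_less_iff) (auto simp: dist_norm ne intro!: bdd_belowI[where m = 0])
  qed
  then obtain y where y: "\<And>n. y n \<in> Y" "\<And>n. norm (x - y n) < d + inverse (Suc n)"
    by metis
  \<comment> \<open>The midpoint of \<open>y m\<close> and \<open>y n\<close> lies in
    \<open>Y\<close>, so its distance from \<open>x\<close> is at least \<open>d\<close>. The
    parallelogram law then bounds the squared gap by
    \<open>4 * (d + \<eta>)^2 - (2 * d)^2\<close>.\<close>
  have near: "(norm (y m - y n))\<^sup>2 \<le> 4 * (2 * d + 1) * inverse (Suc N)" if "m \<ge> N" "n \<ge> N" for m n N
  proof -
    define \<eta> where "\<eta> = inverse (real (Suc N))"
    have \<eta>: "0 < \<eta>" "\<eta> \<le> 1" by (auto simp: \<eta>_def inverse_eq_divide)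
    have le: "norm (x - y k) \<le> d + \<eta>" if "k \<ge> N" for k
    proof -
      have "inverse (real (Suc k)) \<le> \<eta>"
        using that by (simp add: \<eta>_def)
      then show ?thesis using y(2)[of k] by linarith
    qed
    have sq: "(norm (x - y k))\<^sup>2 \<le> (d + \<eta>)\<^sup>2" if "k \<ge> N" for k
      using le[OF that] by (intro power_mono) auto
    have "(1/2) *\<^sub>R (y m + y n) \<in> Y"
      using sub y(1) by (simp add: scaleR_scaleC complex_vector.subspace_def)
    then have "d \<le> norm (x - (1/2) *\<^sub>R (y m + y n))" by (rule d_le)
    moreover have "(x - y m) + (x - y n) = 2 *\<^sub>R (x - (1/2) *\<^sub>R (y m + y n))"
      by (simp add: algebra_simps scaleR_2)
    then have "norm ((x - y m) + (x - y n)) = 2 * norm (x - (1/2) *\<^sub>R (y m + y n))" by simp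
    ultimately have "(2 * d)\<^sup>2 \<le> (norm ((x - y m) + (x - y n)))\<^sup>2"
      using d0 by (intro power_mono) auto
    moreover have "(norm ((x - y m) - (x - y n)))\<^sup>2 = (norm (y m - y n))\<^sup>2"
      by (simp add: norm_minus_commute)
    ultimately have "(norm (y m - y n))\<^sup>2 \<le> 4 * (d + \<eta>)\<^sup>2 - (2 * d)\<^sup>2"
      using parallelogram[of "x - y m" "x - y n"] sq[OF that(1)] sq[OF that(2)] by linarith
    also have "\<dots> = 4 * \<eta> * (2 * d + \<eta>)"
      by (simp add: power2_eq_square algebra_simps)
    also have "\<dots> \<le> 4 * \<eta> * (2 * d + 1)"
      using \<eta> by (intro mult_left_mono) auto
    finally show ?thesis by (simp add: \<eta>_def algebra_simps)
  qed
  have "Cauchy y"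
  proof (rule metric_CauchyI)
    fix e :: real assume e: "e > 0"
    have "(\<lambda>N. 4 * (2 * d + 1) * inverse (real (Suc N))) \<longlonglongrightarrow> 4 * (2 * d + 1) * 0"
      by (intro tendsto_intros LIMSEQ_inverse_real_of_nat)
    then have "\<forall>\<^sub>F N in sequentially. 4 * (2 * d + 1) * inverse (real (Suc N)) < e\<^sup>2"
      by (rule order_tendstoD(2)) (use e in simp)
    then obtain N where "4 * (2 * d + 1) * inverse (real (Suc N)) < e\<^sup>2"
      by (auto simp: eventually_sequentially)
    then have "(norm (y m - y n))\<^sup>2 < e\<^sup>2" if "m \<ge> N" "n \<ge> N" for m n
      using near[OF that] by linarith
    then show "\<exists>M. \<forall>m\<ge>M. \<forall>n\<ge>M. dist (y m) (y n) < e"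
      using e by (metis dist_norm less_imp_le power2_less_imp_less)
  qed
  then obtain p where p: "y \<longlonglongrightarrow> p"
    using Cauchy_convergent_iff convergent_def by blast
  have pY: "p \<in> Y"
    using closed_sequentially[OF cl] y(1) p by blast
  have "norm (x - p) \<le> d + 0"
  proof (rule LIMSEQ_le)
    show "(\<lambda>n. d + inverse (real (Suc n))) \<longlonglongrightarrow> d + 0"
      by (intro tendsto_intros LIMSEQ_inverse_real_of_nat)
    show "(\<lambda>n. norm (x - y n)) \<longlonglongrightarrow> norm (x - p)"
      by (intro tendsto_intros p)
  qed (use y(2) less_imp_le in blast)
  then have pd: "norm (x - p) \<le> d" by simp
  have "cinner (x - p) z = 0" if "z \<in> Y" for z
  proof (cases "z = 0")
    case False
    \<comment> \<open>Moving \<open>p\<close> by the component of \<open>x - p\<close> along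
      \<open>z\<close> would bring it strictly closer to \<open>x\<close> unless that component
      vanishes.\<close>
    define c where "c = cinner (x - p) z / of_real ((norm z)\<^sup>2)"
    have "p + c *\<^sub>C z \<in> Y"
      using sub pY that by (simp add: complex_vector.subspace_def)
    then have "d \<le> norm (x - (p + c *\<^sub>C z))" by (rule d_le)
    then have "(norm (x - p))\<^sup>2 \<le> (norm (x - p - c *\<^sub>C z))\<^sup>2"
      using pd by (intro power_mono) (auto simp: diff_diff_eq)
    then have "(cmod (cinner (x - p) z))\<^sup>2 / (norm z)\<^sup>2 \<le> 0"
      unfolding c_def norm_minus_component_squared[OF False] by simp
    then show ?thesis
      using False by (simp add: divide_le_0_iff)
  qed simp
  then show ?thesis
    using pY by (auto simp: orth_compl_def)
qed

text \<open>For a closed subspace such a \<open>y\<close> exists and is unique, so this is the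
  orthogonal projection. For other sets the choice may be arbitrary.\<close>

definition oproj :: "'a::complex_inner set \<Rightarrow> 'a \<Rightarrow> 'a" where
  "oproj Y x = (SOME y. y \<in> Y \<and> x - y \<in> orth_compl Y)"

context
  fixes Y :: "'a::chilbert_space set"
  assumes sub: "csubspace Y" and cl: "closed Y"
begin

lemma oproj_mem: "oproj Y x \<in> Y" and oproj_orth: "x - oproj Y x \<in> orth_compl Y"
proof -
  have "oproj Y x \<in> Y \<and> x - oproj Y x \<in> orth_compl Y"
    unfolding oproj_def
    by (rule someI_ex) (use orthogonal_projection_exists[OF sub cl, of x] in blast)
  then show "oproj Y x \<in> Y" "x - oproj Y x \<in> orth_compl Y" by auto
qed

lemma oproj_unique:
  assumes "y \<in> Y" "x - y \<in> orth_compl Y"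
  shows "oproj Y x = y"
proof -
  have "y - oproj Y x \<in> Y"
    using assms(1) oproj_mem sub by (simp add: complex_vector.subspace_diff)
  moreover have "y - oproj Y x \<in> orth_compl Y"
    using complex_vector.subspace_diff[OF csubspace_orth_compl oproj_orth assms(2), of x] by simp
  ultimately have "cinner (y - oproj Y x) (y - oproj Y x) = 0"
    by (auto simp: orth_compl_def)
  then show ?thesis by simp
qed

lemma oproj_fixed: "y \<in> Y \<Longrightarrow> oproj Y y = y"
  by (rule oproj_unique) (auto simp: csubspace_orth_compl complex_vector.subspace_0)

lemma oproj_orth_compl: "z \<in> orth_compl Y \<Longrightarrow> oproj Y z = 0"
  by (rule oproj_unique) (auto simp: sub complex_vector.subspace_0)

lemma oproj_add: "oproj Y (x + y) = oproj Y x + oproj Y y"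
proof (rule oproj_unique)
  show "x + y - (oproj Y x + oproj Y y) \<in> orth_compl Y"
    using complex_vector.subspace_add[OF csubspace_orth_compl oproj_orth oproj_orth, of x y]
    by (simp add: algebra_simps)
qed (intro complex_vector.subspace_add sub oproj_mem)

lemma oproj_scaleC: "oproj Y (c *\<^sub>C x) = c *\<^sub>C oproj Y x"
proof (rule oproj_unique)
  show "c *\<^sub>C x - c *\<^sub>C oproj Y x \<in> orth_compl Y"
    using complex_vector.subspace_scale[OF csubspace_orth_compl oproj_orth, of c x]
    by (simp add: complex_vector.scale_right_diff_distrib)
qed (intro complex_vector.subspace_scale sub oproj_mem)

lemma norm_oproj_le: "norm (oproj Y x) \<le> norm x"
proof -
  have "cinner (oproj Y x) (x - oproj Y x) = 0"
    using oproj_orth[of x] oproj_mem[of x] by (subst cinner_eq_zero_sym) (simp add: orth_compl_def)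
  from norm_add_squared_orthogonal[OF this] have "(norm (oproj Y x))\<^sup>2 \<le> (norm x)\<^sup>2"
    by simp
  then show ?thesis by (rule power2_le_imp_le) simp
qed

lemma bounded_op_oproj: "bounded_op UNIV Y (oproj Y)"
  unfolding bounded_op_def
  using oproj_mem oproj_add oproj_scaleC norm_oproj_le by (auto intro!: exI[of _ 1])

lemma orth_decompositionI: "orth_decomposition Y"
  unfolding orth_decomposition_def
proof (intro conjI sub cl csubspace_orth_compl closed_orth_compl allI)
  fix x
  show "\<exists>y\<in>Y. \<exists>z\<in>orth_compl Y. x = y + z"
    by (rule bexI[OF _ oproj_mem[of x]], rule bexI[OF _ oproj_orth[of x]]) simp
qed

lemma dense_if_orth_compl_trivial:
  assumes "\<And>v. v \<in> orth_compl Y \<Longrightarrow> v = 0"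
  shows "Y = UNIV"
proof (rule set_eqI, simp)
  fix x
  show "x \<in> Y"
    using assms[OF oproj_orth[of x]] oproj_mem[of x] by simp
qed

end

section \<open>Bounded operators on the whole space\<close>

lemma bounded_op_UNIV_linear: "bounded_op UNIV UNIV A \<Longrightarrow> bounded_linear A"
  by (simp add: bounded_op_UNIV_iff)

lemma bounded_op_scaleC: "bounded_op UNIV UNIV A \<Longrightarrow> A (c *\<^sub>C x) = c *\<^sub>C A x"
  by (simp add: bounded_op_UNIV_iff)

lemma bounded_op_comp:
  "bounded_op UNIV UNIV A \<Longrightarrow> bounded_op UNIV UNIV B \<Longrightarrow> bounded_op UNIV UNIV (\<lambda>x. A (B x))"
  by (auto simp: bounded_op_UNIV_iff bounded_linear_compose)

lemma bounded_op_add: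
  "bounded_op UNIV UNIV A \<Longrightarrow> bounded_op UNIV UNIV B \<Longrightarrow> bounded_op UNIV UNIV (\<lambda>x. A x + B x)"
  by (auto simp: bounded_op_UNIV_iff bounded_linear_add scaleC_add_right)

lemma bounded_op_diff:
  "bounded_op UNIV UNIV A \<Longrightarrow> bounded_op UNIV UNIV B \<Longrightarrow> bounded_op UNIV UNIV (\<lambda>x. A x - B x)"
  by (auto simp: bounded_op_UNIV_iff bounded_linear_sub complex_vector.scale_right_diff_distrib)

lemma bounded_op_ident: "bounded_op UNIV UNIV (\<lambda>x. x)"
  by (auto simp: bounded_op_UNIV_iff bounded_linear_ident)

lemma bounded_op_scale: "bounded_op UNIV UNIV (\<lambda>x. c *\<^sub>C x)"
  by (auto simp: bounded_op_UNIV_iff bounded_linear_scaleC_right scaleC_scaleC mult.commute)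

lemma bounded_op_restrict:
  "bounded_op UNIV UNIV A \<Longrightarrow> (\<And>x. x \<in> U \<Longrightarrow> A x \<in> V) \<Longrightarrow> bounded_op U V A"
  by (auto simp: bounded_op_def)

text \<open>Riesz representation of the functional sending \<open>x\<close> to
  \<open>cinner (A x) w\<close>: a nonzero vector orthogonal to its kernel, suitably scaled,
  represents it. The resulting \<open>v\<close> is the adjoint of \<open>A\<close> applied to
  \<open>w\<close>.\<close>

lemma adjoint_exists:
  fixes A :: "'a::chilbert_space \<Rightarrow> 'a"
  assumes A: "bounded_op UNIV UNIV A"
  shows "\<exists>v. \<forall>x. cinner (A x) w = cinner x v"
proof -
  interpret A: bounded_linear A using A by (rule bounded_op_UNIV_linear)
  define N where "N = {x. cinner (A x) w = 0}"
  have sub: "csubspace N"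
    by (auto simp: N_def complex_vector.subspace_def A.zero A.add bounded_op_scaleC[OF A] cinner_simps)
  have cl: "closed N"
    unfolding N_def
    by (intro closed_Collect_eq continuous_intros bounded_linear.continuous_on[OF bounded_linear_cinner_left]
        A.continuous_on continuous_on_id)
  show ?thesis
  proof (cases "N = UNIV")
    case True
    then show ?thesis by (auto simp: N_def intro!: exI[of _ 0])
  next
    case False
    then obtain u where u: "u \<in> orth_compl N" "u \<noteq> 0"
      using dense_if_orth_compl_trivial[OF sub cl] by blast
    define q where "q = cinner (A u) w"
    have "u \<notin> N"
      using u by (auto simp: orth_compl_def)
    then have q: "q \<noteq> 0" by (simp add: N_def q_def)
    \<comment> \<open>Subtracting from \<open>x\<close> the multiple of \<open>u\<close> on which
      the functional has the same value leaves a vector of the kernel \<open>N\<close>, which is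
      orthogonal to \<open>u\<close>.\<close>
    have "cinner (A x) w = cinner x ((cnj q / of_real ((norm u)\<^sup>2)) *\<^sub>C u)" for x
    proof -
      have "x - (cinner (A x) w / q) *\<^sub>C u \<in> N"
        using q by (simp add: N_def A.diff bounded_op_scaleC[OF A] cinner_simps q_def)
      then have "cinner (x - (cinner (A x) w / q) *\<^sub>C u) u = 0"
        using u(1) by (subst cinner_eq_zero_sym) (simp add: orth_compl_def)
      then have "cinner x u = (cinner (A x) w / q) * of_real ((norm u)\<^sup>2)"
        by (simp add: cinner_simps cinner_self)
      then show ?thesis
        using q u(2) by (simp add: cinner_scaleC_right)
    qed
    then show ?thesis by blast
  qed
qed

section \<open>Spectrum and resolvent growth\<close>

text \<open>Solving \<open>x + A x = y\<close> means finding a fixed point of the contraction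
  \<open>x \<mapsto> y - A x\<close>. Uniqueness of the solution makes the inverse linear, and its
  norm is at most \<open>1 / (1 - c')\<close>.\<close>

lemma invertible_op_ident_add:
  fixes A :: "'a::chilbert_space \<Rightarrow> 'a"
  assumes A: "bounded_op UNIV UNIV A" and c: "c < 1" and le: "\<And>x. norm (A x) \<le> c * norm x"
  shows "invertible_op (\<lambda>x. x + A x)"
proof -
  interpret A: bounded_linear A using A by (rule bounded_op_UNIV_linear)
  \<comment> \<open>The fixed point theorem asks for a nonnegative constant, while \<open>c\<close>
    can be negative on the zero space.\<close>
  define c' where "c' = max c 0"
  have c': "0 \<le> c'" "c' < 1" using c by (auto simp: c'_def)
  have le': "norm (A x) \<le> c' * norm x" for x
    using le[of x] mult_right_mono[of c c' "norm x"] by (simp add: c'_def)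
  have "\<exists>!x. y - A x = x" for y
  proof (rule banach_fix_type[OF c'], intro allI)
    fix x z
    show "dist (y - A x) (y - A z) \<le> c' * dist x z"
      using le'[of "z - x"] by (simp add: dist_norm A.diff norm_minus_commute)
  qed
  then have "\<exists>!x. x + A x = y" for y
    by (metis add_diff_cancel_right' diff_add_cancel)
  then obtain B where B: "\<And>y. B y + A (B y) = y" and uniq: "\<And>x y. x + A x = y \<Longrightarrow> x = B y"
    by metis
  have "norm (B y) \<le> (1 / (1 - c')) * norm y" for y
  proof -
    have "norm (B y) - norm (A (B y)) \<le> norm y"
      using norm_diff_ineq[of "B y" "A (B y)"] by (simp add: B)
    then have "(1 - c') * norm (B y) \<le> norm y"
      using le'[of "B y"] by (simp add: algebra_simps)
    then show ?thesis
      using c' by (simp add: field_simps)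
  qed
  moreover have "B (x + y) = B x + B y" for x y
    by (rule uniq[symmetric]) (use B[of x] B[of y] in \<open>simp add: A.add algebra_simps\<close>)
  moreover have "B (k *\<^sub>C x) = k *\<^sub>C B x" for k x
    by (rule uniq[symmetric])
       (use B[of x] in \<open>simp add: bounded_op_scaleC[OF A] complex_vector.scale_right_distrib[symmetric]\<close>)
  ultimately have "bounded_op UNIV UNIV B"
    unfolding bounded_op_def by blast
  moreover have "B (x + A x) = x" for x
    using uniq by metis
  ultimately show ?thesis
    unfolding invertible_op_def
    using bounded_op_add[OF bounded_op_ident A] B by (intro conjI exI[of _ B]) (auto simp: fun_eq_iff)
qed

lemma invertible_op_comp:
  assumes "invertible_op A" "invertible_op B"
  shows "invertible_op (\<lambda>x. A (B x))"
proof -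
  obtain A' B' where "bounded_op UNIV UNIV A'" "A \<circ> A' = id" "A' \<circ> A = id"
      "bounded_op UNIV UNIV B'" "B \<circ> B' = id" "B' \<circ> B = id"
    using assms by (auto simp: invertible_op_def)
  then show ?thesis
    using assms unfolding invertible_op_def
    by (intro conjI exI[of _ "\<lambda>x. B' (A' x)"]) (auto simp: fun_eq_iff bounded_op_comp)
qed

text \<open>Factor \<open>T - q\<close> as \<open>(I + (p - q) B) (T - p)\<close>, where
  \<open>B\<close> inverts \<open>T - p\<close>. The lower bound \<open>m\<close> gives
  \<open>B\<close> norm at most \<open>1 / m\<close>, so the perturbation of \<open>I\<close> has
  norm below 1.\<close>

lemma invertible_op_perturb:
  fixes T :: "'a::chilbert_space \<Rightarrow> 'a"
  assumes inv: "invertible_op (\<lambda>x. T x - p *\<^sub>C x)"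
    and below: "\<And>x. m * norm x \<le> norm (T x - p *\<^sub>C x)"
    and near: "cmod (q - p) < m"
  shows "invertible_op (\<lambda>x. T x - q *\<^sub>C x)"
proof -
  define A where "A = (\<lambda>x. T x - p *\<^sub>C x)"
  obtain B where B: "bounded_op UNIV UNIV B" "\<And>x. A (B x) = x" "\<And>x. B (A x) = x"
    using inv by (auto simp: A_def invertible_op_def fun_eq_iff)
  have m: "m > 0" using near norm_ge_zero[of "q - p"] by linarith
  define C where "C = (\<lambda>x. (p - q) *\<^sub>C B x)"
  have C: "bounded_op UNIV UNIV C"
    unfolding C_def by (rule bounded_op_comp[OF bounded_op_scale B(1)])
  have C_le: "norm (C x) \<le> (cmod (q - p) / m) * norm x" for x
  proof -
    have "m * norm (B x) \<le> norm x"
      using below[of "B x"] B(2)[of x] by (simp add: A_def)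
    then have "norm (B x) \<le> norm x / m"
      using m by (simp add: field_simps)
    then have "cmod (q - p) * norm (B x) \<le> cmod (q - p) * (norm x / m)"
      by (rule mult_left_mono) simp
    then show ?thesis
      by (simp add: C_def norm_minus_commute)
  qed
  have "invertible_op (\<lambda>x. x + C x)"
    by (rule invertible_op_ident_add[OF C _ C_le]) (use m near in simp)
  then have "invertible_op (\<lambda>x. A x + C (A x))"
    using invertible_op_comp[of "\<lambda>x. x + C x" A] inv by (simp add: A_def)
  moreover have "A x + C (A x) = T x - q *\<^sub>C x" for x
    unfolding C_def B(3)
    by (simp add: A_def complex_vector.scale_left_diff_distrib)
  ultimately show ?thesis by simp
qed

lemma bounded_below_if_invertible:
  fixes A :: "'a::complex_inner \<Rightarrow> 'a"
  assumes "invertible_op A"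
  shows "\<exists>m>0. \<forall>x. m * norm x \<le> norm (A x)"
proof -
  obtain B where B: "bounded_op UNIV UNIV B" "\<And>x. B (A x) = x"
    using assms by (auto simp: invertible_op_def fun_eq_iff)
  obtain M where M: "M > 0" "\<And>x. norm (B x) \<le> norm x * M"
    using bounded_linear.pos_bounded[OF bounded_op_UNIV_linear[OF B(1)]] by blast
  have "norm x \<le> norm (A x) * M" for x
    using M(2)[of "A x"] by (simp add: B(2))
  then show ?thesis
    using M(1) by (intro exI[of _ "1 / M"]) (simp add: field_simps)
qed

text \<open>By Baire, one of the closed sets \<open>C m\<close>, which cover the space, contains a
  ball. Every vector of length \<open>r\<close> is a difference of two points of that ball, which
  gives the constant \<open>2 * m / r\<close>.\<close>

lemma uniform_boundedness:
  fixes R :: "nat \<Rightarrow> 'a::banach \<Rightarrow> 'b::real_normed_vector"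
  assumes lin: "\<And>n. bounded_linear (R n)" and pw: "\<And>x. \<exists>M. \<forall>n. norm (R n x) \<le> M"
  shows "\<exists>M. \<forall>n x. norm (R n x) \<le> M * norm x"
proof -
  define C where "C = (\<lambda>m::nat. {x. \<forall>n. norm (R n x) \<le> real m})"
  have C: "closed (C m)" for m
    unfolding C_def
    by (intro closed_Collect_all closed_Collect_le continuous_intros
        bounded_linear.continuous_on[OF lin] continuous_on_id)
  have "(\<Union>(range C)) = UNIV"
  proof -
    have "\<exists>m. x \<in> C m" for x
    proof -
      obtain M where "\<And>n. norm (R n x) \<le> M" using pw by blast
      moreover obtain m where "M \<le> real m" using real_arch_simple by blast
      ultimately show ?thesis unfolding C_def using order_trans by blast
    qed
    then show ?thesis by auto
  qed
  moreover have "interior (\<Union>(range C)) = {}" if "\<forall>m. interior (C m) = {}"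
    using Baire_category_alt[of "euclidean :: 'a topology" "range C"] C that
    by (force simp: completely_metrizable_space_euclidean)
  ultimately have "\<not> (\<forall>m. interior (C m) = {})" by auto
  then obtain m x0 where "x0 \<in> interior (C m)" by auto
  then obtain r where r: "r > 0" "cball x0 r \<subseteq> C m"
    by (auto simp: mem_interior_cball)
  have "norm (R n x) \<le> (2 * m / r) * norm x" for n x
  proof (cases "x = 0")
    case True
    then show ?thesis by (simp add: bounded_linear.linear[OF lin] linear_0)
  next
    case False
    interpret bounded_linear "R n" by (rule lin)
    define z where "z = (r / norm x) *\<^sub>R x"
    have "norm z = r" using False r(1) by (simp add: z_def)
    then have "x0 \<in> C m" "x0 + z \<in> C m"
      using r by (auto intro!: subsetD[OF r(2)] simp: dist_norm)
    then have "norm (R n x0) \<le> m" "norm (R n (x0 + z)) \<le> m"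
      by (auto simp: C_def)
    moreover have "R n z = R n (x0 + z) - R n x0" by (simp add: add)
    ultimately have "norm (R n z) \<le> 2 * m"
      using norm_triangle_ineq4[of "R n (x0 + z)" "R n x0"] by simp
    then have "(r / norm x) * norm (R n x) \<le> 2 * m"
      using r(1) by (simp add: z_def scaleR)
    then show ?thesis
      using r(1) False by (simp add: field_simps)
  qed
  then show ?thesis by blast
qed

text \<open>An invertible \<open>T - l\<close> is bounded below, so it stays invertible under small
  changes of \<open>l\<close>: the resolvent set is open.\<close>

lemma spectrum_closed_point:
  fixes T :: "'a::chilbert_space \<Rightarrow> 'a"
  assumes "l \<in> closure (op_spectrum T)"
  shows "l \<in> op_spectrum T"
proof (rule ccontr)
  assume "l \<notin> op_spectrum T"
  then have inv: "invertible_op (\<lambda>x. T x - l *\<^sub>C x)"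
    by (simp add: op_spectrum_def)
  then obtain m where m: "m > 0" "\<And>x. m * norm x \<le> norm (T x - l *\<^sub>C x)"
    using bounded_below_if_invertible by blast
  obtain q where "q \<in> op_spectrum T" "dist q l < m"
    using assms m(1) by (auto simp: closure_approachable)
  then show False
    using invertible_op_perturb[OF inv m(2), of q] by (simp add: op_spectrum_def dist_norm)
qed

text \<open>The resolvents at points \<open>p n\<close> of the resolvent set that tend to \<open>l\<close> cannot be uniformly
  bounded, so they blow up on a single vector \<open>e\<close>; normalizing the \<open>(T - p n)\<^sup>-\<^sup>1 e\<close> gives \<open>x\<close>.\<close>

lemma approximate_eigenvectors:
  fixes T :: "'a::chilbert_space \<Rightarrow> 'a"
  assumes T: "bounded_op UNIV UNIV T" and l: "l \<in> frontier (op_spectrum T)"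
  shows "\<exists>e x \<nu> \<alpha>. norm e = 1 \<and> (\<forall>n. norm (x n) = 1) \<and> (\<forall>n. \<alpha> n > (0::real)) \<and>
    (\<forall>n::nat. T (x n) = l *\<^sub>C x n + \<nu> n *\<^sub>C x n + \<alpha> n *\<^sub>R e) \<and> \<nu> \<longlonglongrightarrow> 0 \<and> \<alpha> \<longlonglongrightarrow> 0"
proof -
  have l_sp: "l \<in> op_spectrum T"
    using l by (intro spectrum_closed_point) (simp add: frontier_def)
  have "l \<in> closure (- op_spectrum T)"
    using l by (simp add: frontier_closures)
  then obtain p where p: "\<And>n. p n \<notin> op_spectrum T" "p \<longlonglongrightarrow> l"
    unfolding closure_sequential by auto
  have inv: "invertible_op (\<lambda>x. T x - p n *\<^sub>C x)" for n
    using p(1) by (simp add: op_spectrum_def)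
  then have "\<exists>R. bounded_op UNIV UNIV R \<and> (\<forall>x. T (R x) - p n *\<^sub>C R x = x) \<and> (\<forall>x. R (T x - p n *\<^sub>C x) = x)" for n
    unfolding invertible_op_def by (force simp: fun_eq_iff)
  then obtain R where R: "\<And>n. bounded_op UNIV UNIV (R n)"
      "\<And>n x. T (R n x) - p n *\<^sub>C R n x = x" "\<And>n x. R n (T x - p n *\<^sub>C x) = x"
    by metis
  \<comment> \<open>If all resolvents had norm at most \<open>M\<close>, each \<open>T - p n\<close>
    would be bounded below by \<open>1 / M\<close>. A point \<open>p n\<close> within
    \<open>1 / M\<close> of \<open>l\<close> would then make \<open>T - l\<close>
    invertible.\<close>
  have "\<not> (\<exists>M. \<forall>n x. norm (R n x) \<le> M * norm x)"
  proof
    assume "\<exists>M. \<forall>n x. norm (R n x) \<le> M * norm x"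
    then obtain M0 where M0: "\<And>n x. norm (R n x) \<le> M0 * norm x" by blast
    define M where "M = max M0 1"
    have M: "M > 0" "norm (R n x) \<le> M * norm x" for n x
      using M0[of n x] mult_right_mono[of M0 M "norm x"] by (auto simp: M_def)
    have "\<forall>\<^sub>F n in sequentially. dist (p n) l < 1 / M"
      using p(2) M(1) by (intro tendstoD) auto
    then obtain n where n: "dist (p n) l < 1 / M"
      by (auto simp: eventually_sequentially)
    have "1 / M * norm x \<le> norm (T x - p n *\<^sub>C x)" for x
      using M(2)[of n "T x - p n *\<^sub>C x"] M(1) by (simp add: R(3) field_simps)
    from invertible_op_perturb[OF inv this, of l] n l_sp show False
      by (simp add: op_spectrum_def dist_norm norm_minus_commute)
  qed
  then obtain e0 where e0: "\<And>M. \<exists>n. norm (R n e0) > M"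
    using uniform_boundedness[of R] R(1) bounded_op_UNIV_linear by (meson not_le)
  have lin: "bounded_linear (R n)" for n using R(1) by (rule bounded_op_UNIV_linear)
  have "e0 \<noteq> 0"
    using e0[of 0] by (auto simp: linear_0[OF bounded_linear.linear[OF lin]])
  define e where "e = (1 / norm e0) *\<^sub>R e0"
  have e1: "norm e = 1" using \<open>e0 \<noteq> 0\<close> by (simp add: e_def)
  have unb: "\<exists>n. norm (R n e) > M" for M
  proof -
    obtain n where "norm (R n e0) > M * norm e0" using e0 by blast
    then have "norm (R n e) > M"
      using \<open>e0 \<noteq> 0\<close> by (simp add: e_def linear_scale[OF bounded_linear.linear[OF lin]] field_simps)
    then show ?thesis by blast
  qed
  have "\<exists>n. norm (R n e) > real k + 1 \<and> dist (p n) l < inverse (Suc k)" for k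
  proof -
    obtain N where N: "\<And>n. n \<ge> N \<Longrightarrow> dist (p n) l < inverse (Suc k)"
      using p(2) by (metis lim_sequentially of_nat_0_less_iff positive_imp_inverse_positive zero_less_Suc)
    \<comment> \<open>A norm exceeding the sum of the first \<open>N\<close> norms forces
      \<open>n \<ge> N\<close>, where \<open>p n\<close> is already close to
      \<open>l\<close>.\<close>
    obtain n where n: "norm (R n e) > (\<Sum>i<N. norm (R i e)) + (real k + 1)"
      using unb by blast
    have "n \<ge> N"
    proof (rule ccontr)
      assume "\<not> n \<ge> N"
      then have "norm (R n e) \<le> (\<Sum>i<N. norm (R i e))"
        by (intro member_le_sum) auto
      with n show False by simp
    qed
    moreover have "(\<Sum>i<N. norm (R i e)) \<ge> 0" by (rule sum_nonneg) simp
    then have "norm (R n e) > real k + 1" using n by linarith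
    ultimately show ?thesis using N by blast
  qed
  then obtain s where s: "\<And>k. norm (R (s k) e) > real k + 1" "\<And>k. dist (p (s k)) l < inverse (Suc k)"
    by metis
  define h where "h = (\<lambda>k. R (s k) e)"
  have h: "norm (h k) > real k + 1" "norm (h k) > 0" "h k \<noteq> 0" for k
    using s(1)[of k] by (auto simp: h_def)
  have Th: "T (h k) = p (s k) *\<^sub>C h k + e" for k
    using R(2)[of "s k" e] by (simp add: h_def algebra_simps)
  have Tlin: "bounded_linear T" using T by (rule bounded_op_UNIV_linear)
  define x where "x = (\<lambda>k. (1 / norm (h k)) *\<^sub>R h k)"
  have "T (x k) = l *\<^sub>C x k + (p (s k) - l) *\<^sub>C x k + (1 / norm (h k)) *\<^sub>R e" for k
  proof -
    have "T (x k) = (1 / norm (h k)) *\<^sub>R (p (s k) *\<^sub>C h k + e)"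
      by (simp add: x_def linear_scale[OF bounded_linear.linear[OF Tlin]] Th)
    also have "\<dots> = p (s k) *\<^sub>C x k + (1 / norm (h k)) *\<^sub>R e"
      by (simp add: x_def scaleR_scaleC scaleC_scaleC scaleC_add_right mult.commute)
    finally show ?thesis
      by (simp add: scaleC_add_left[symmetric])
  qed
  moreover have "norm (x k) = 1" for k using h(3) by (simp add: x_def)
  moreover have "(\<lambda>k. p (s k) - l) \<longlonglongrightarrow> 0"
  proof (rule Lim_null_comparison[OF _ LIMSEQ_inverse_real_of_nat])
    show "\<forall>\<^sub>F k in sequentially. norm (p (s k) - l) \<le> inverse (real (Suc k))"
      using s(2) by (simp add: dist_norm less_imp_le)
  qed
  moreover have "(\<lambda>k. 1 / norm (h k)) \<longlonglongrightarrow> 0"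
  proof (rule Lim_null_comparison[OF _ LIMSEQ_inverse_real_of_nat])
    show "\<forall>\<^sub>F k in sequentially. norm (1 / norm (h k)) \<le> inverse (real (Suc k))"
      using h(1,2) by (intro always_eventually allI)
        (simp add: inverse_eq_divide frac_le less_imp_le add.commute)
  qed
  moreover have "1 / norm (h k) > 0" for k using h(2) by simp
  ultimately show ?thesis
    using e1 by (intro exI[of _ e] exI[of _ x] exI[of _ "\<lambda>k. p (s k) - l"] exI[of _ "\<lambda>k. 1 / norm (h k)"])
      auto
qed

text \<open>If \<open>A x\<^sub>n \<rightarrow> 0\<close>, then \<open>\<langle>x\<^sub>n, v\<rangle> \<rightarrow> 0\<close> for \<open>v\<close> in the range of the adjoint of \<open>A\<close>, which is
  dense when \<open>A\<close> is injective.\<close>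

lemma weakly_null:
  fixes A :: "'a::chilbert_space \<Rightarrow> 'a"
  assumes A: "bounded_op UNIV UNIV A" and inj: "\<And>x. A x = 0 \<Longrightarrow> x = 0"
    and bdd: "\<And>n. norm (x n) \<le> 1" and null: "(\<lambda>n. A (x n)) \<longlonglongrightarrow> 0"
  shows "(\<lambda>n. cinner (x n) v) \<longlonglongrightarrow> 0"
proof -
  define N where "N = {v. (\<lambda>n. cinner (x n) v) \<longlonglongrightarrow> 0}"
  have sub: "csubspace N"
    unfolding complex_vector.subspace_def N_def
    using tendsto_add_zero tendsto_mult_right_zero by (auto simp: cinner_add_right cinner_scaleC_right)
  \<comment> \<open>\<open>N\<close> is closed because the \<open>x n\<close> are uniformly bounded:
    Cauchy-Schwarz costs \<open>e / 2\<close> for replacing \<open>v\<close> by a nearby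
    \<open>u\<close> in \<open>N\<close>, and \<open>u\<close> itself contributes at most another
    \<open>e / 2\<close>.\<close>
  have "v \<in> N" if v: "v \<in> closure N" for v
    unfolding N_def mem_Collect_eq
  proof (rule tendstoI)
    fix e :: real assume e: "e > 0"
    obtain u where u: "u \<in> N" "dist u v < e / 2"
      using v e half_gt_zero unfolding closure_approachable by blast
    have "\<forall>\<^sub>F n in sequentially. dist (cinner (x n) u) 0 < e / 2"
      using u(1) e by (intro tendstoD) (auto simp: N_def)
    then show "\<forall>\<^sub>F n in sequentially. dist (cinner (x n) v) 0 < e"
    proof eventually_elim
      case (elim n)
      have "cmod (cinner (x n) (v - u)) \<le> norm (x n) * norm (v - u)" by (rule norm_cinner_le)
      also have "\<dots> \<le> 1 * norm (v - u)" using bdd by (rule mult_right_mono) simp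
      finally have "cmod (cinner (x n) (v - u)) < e / 2"
        using u(2) by (simp add: dist_norm norm_minus_commute)
      then have "cmod (cinner (x n) (v - u) + cinner (x n) u) < e"
        using elim norm_triangle_ineq[of "cinner (x n) (v - u)" "cinner (x n) u"] by simp
      then show ?case by (simp add: cinner_diff_right)
    qed
  qed
  then have cl: "closed N" using closure_subset_eq by blast
  have "N = UNIV"
  proof (rule dense_if_orth_compl_trivial[OF sub cl])
    fix v assume v: "v \<in> orth_compl N"
    \<comment> \<open>Here \<open>u\<close> is the adjoint of \<open>A\<close> applied to
      \<open>w\<close>. It belongs to \<open>N\<close> since \<open>A (x n)\<close> tends to 0, so
      \<open>v\<close> is orthogonal to it.\<close>
    have "cinner (A v) w = 0" for w
    proof -
      obtain u where u: "\<And>x. cinner (A x) w = cinner x u" using adjoint_exists[OF A] by blast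
      have "(\<lambda>n. cinner (A (x n)) w) \<longlonglongrightarrow> cinner 0 w"
        by (rule bounded_linear.tendsto[OF bounded_linear_cinner_left null])
      then have "u \<in> N" by (simp add: N_def u)
      then show ?thesis using v by (simp add: u orth_compl_def)
    qed
    then show "v = 0" using inj cinner_self_eq_zero by blast
  qed
  then show ?thesis by (auto simp: N_def)
qed

section \<open>Operators given by summable series\<close>

lemma geometric_half_bound:
  fixes b :: "nat \<Rightarrow> 'a::banach"
  assumes le: "\<And>k. norm (b k) \<le> C * (1/2)^k"
  shows "summable (\<lambda>k. norm (b k))" "(\<Sum>k. norm (b k)) \<le> 2 * C"
proof -
  have g: "(\<lambda>k. C * (1/2)^k) sums (C * 2)"
    by (intro sums_mult) (use geometric_sums[of "1/2::real"] in simp)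
  show s: "summable (\<lambda>k. norm (b k))"
    by (rule summable_comparison_test'[OF sums_summable[OF g], of 0]) (use le in simp)
  have "(\<Sum>k. norm (b k)) \<le> (\<Sum>k. C * (1/2)^k)"
    by (rule suminf_le[OF le s sums_summable[OF g]])
  also have "\<dots> = C * 2"
    by (rule sums_unique[OF g, symmetric])
  finally show "(\<Sum>k. norm (b k)) \<le> 2 * C" by simp
qed

text \<open>For orthonormal \<open>v\<close> and summable \<open>norm (b k)\<close> this is the
  operator that sends \<open>v k\<close> to \<open>b k\<close> and vanishes on the orthogonal
  complement of the \<open>v k\<close>.\<close>

definition series_op :: "(nat \<Rightarrow> 'a::chilbert_space) \<Rightarrow> (nat \<Rightarrow> 'a) \<Rightarrow> 'a \<Rightarrow> 'a" where
  "series_op v b z = (\<Sum>k. cinner z (v k) *\<^sub>C b k)"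

context
  fixes v b :: "nat \<Rightarrow> 'a::chilbert_space"
  assumes v1: "\<And>k. norm (v k) \<le> 1" and b: "summable (\<lambda>k. norm (b k))"
begin

lemma norm_series_term_le: "norm (cinner z (v k) *\<^sub>C b k) \<le> norm z * norm (b k)"
proof -
  have "cmod (cinner z (v k)) \<le> norm z * 1"
    using norm_cinner_le[of z "v k"] mult_left_mono[OF v1[of k], of "norm z"] by simp
  then show ?thesis
    using mult_right_mono[of "cmod (cinner z (v k))" "norm z" "norm (b k)"] by simp
qed

lemma summable_norm_series_op: "summable (\<lambda>k. norm (cinner z (v k) *\<^sub>C b k))"
  by (rule summable_comparison_test'[OF summable_mult[OF b, of "norm z"], of 0])
     (use norm_series_term_le in simp)

lemmas summable_series_op = summable_norm_cancel[OF summable_norm_series_op]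

lemma norm_series_op_le: "norm (series_op v b z) \<le> (\<Sum>k. norm (b k)) * norm z"
proof -
  have "norm (series_op v b z) \<le> (\<Sum>k. norm (cinner z (v k) *\<^sub>C b k))"
    unfolding series_op_def by (rule summable_norm[OF summable_norm_series_op])
  also have "\<dots> \<le> (\<Sum>k. norm z * norm (b k))"
    by (rule suminf_le[OF norm_series_term_le summable_norm_series_op summable_mult[OF b]])
  also have "\<dots> = (\<Sum>k. norm (b k)) * norm z"
    by (simp add: suminf_mult[OF b])
  finally show ?thesis .
qed

lemma bounded_op_series_op: "bounded_op UNIV UNIV (series_op v b)"
proof -
  have "series_op v b (x + y) = series_op v b x + series_op v b y" for x y
    unfolding series_op_def suminf_add[OF summable_series_op summable_series_op]
    by (simp add: cinner_add_left scaleC_add_left)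
  moreover have "series_op v b (c *\<^sub>C x) = c *\<^sub>C series_op v b x" for c x
    unfolding series_op_def bounded_linear.suminf[OF bounded_linear_scaleC_right summable_series_op]
    by (simp add: cinner_scaleC_left scaleC_scaleC)
  ultimately show ?thesis
    unfolding bounded_op_def using norm_series_op_le by blast
qed

lemma series_op_basis:
  assumes "\<And>i j. cinner (v i) (v j) = (if i = j then 1 else 0)"
  shows "series_op v b (v j) = b j"
proof -
  have "(\<lambda>k. cinner (v j) (v k) *\<^sub>C b k) = (\<lambda>k. if k = j then b k else 0)"
    by (auto simp: assms scaleC_one)
  then show ?thesis
    unfolding series_op_def using sums_unique[OF sums_single[of j b]] by simp
qed

lemma series_op_orthogonal:
  assumes "\<And>k. cinner z (v k) = 0"
  shows "series_op v b z = 0"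
  unfolding series_op_def by (simp add: assms)

text \<open>Each further term adds, as a Minkowski sum, the image of a closed disc of scalars. These
  sets contain the truncations of \<open>series_op\<close> on a ball.\<close>

lemma compact_coefficient_sums:
  "compact {\<Sum>k<N. c k *\<^sub>C b k | c. \<forall>k. cmod (c k) \<le> r}"
proof (induction N)
  case 0
  have "{\<Sum>k<0. c k *\<^sub>C b k | c. \<forall>k. cmod (c k) \<le> r} \<subseteq> {0}" by auto
  then show ?case using finite_subset finite_imp_compact by blast
next
  case (Suc N)
  let ?C = "{\<Sum>k<N. c k *\<^sub>C b k | c. \<forall>k. cmod (c k) \<le> r}"
  let ?D = "(\<lambda>c. c *\<^sub>C b N) ` cball 0 r"
  have D: "compact ?D"
    by (intro compact_continuous_image compact_cball
        bounded_linear.continuous_on[OF bounded_linear_scaleC_left] continuous_on_id)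
  have "{\<Sum>k<Suc N. c k *\<^sub>C b k | c. \<forall>k. cmod (c k) \<le> r} = {x + y | x y. x \<in> ?C \<and> y \<in> ?D}"
  proof (intro equalityI subsetI)
    fix z assume "z \<in> {x + y | x y. x \<in> ?C \<and> y \<in> ?D}"
    then obtain c a where c: "z = (\<Sum>k<N. c k *\<^sub>C b k) + a *\<^sub>C b N"
        "\<forall>k. cmod (c k) \<le> r" "cmod a \<le> r" by auto
    then have "z = (\<Sum>k<Suc N. (c(N := a)) k *\<^sub>C b k)" "\<forall>k. cmod ((c(N := a)) k) \<le> r" by auto
    then show "z \<in> {\<Sum>k<Suc N. c k *\<^sub>C b k | c. \<forall>k. cmod (c k) \<le> r}" by blast
  next
    fix z assume "z \<in> {\<Sum>k<Suc N. c k *\<^sub>C b k | c. \<forall>k. cmod (c k) \<le> r}"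
    then obtain c where c: "z = (\<Sum>k<N. c k *\<^sub>C b k) + c N *\<^sub>C b N" "\<forall>k. cmod (c k) \<le> r" by auto
    then have "(\<Sum>k<N. c k *\<^sub>C b k) \<in> ?C" "c N *\<^sub>C b N \<in> ?D" by auto
    then show "z \<in> {x + y | x y. x \<in> ?C \<and> y \<in> ?D}" using c(1) by blast
  qed
  then show ?case using compact_sums[OF Suc.IH D] by simp
qed

text \<open>The tails of the series are uniformly small on the ball, and the truncated sums lie in a
  compact set; hence the image is totally bounded.\<close>

lemma compact_closure_series_op: "compact (closure (series_op v b ` cball 0 r))"
  unfolding compact_eq_totally_bounded
proof (intro conjI allI impI)
  let ?S = "series_op v b ` cball 0 r"
  show "complete (closure ?S)" by (simp add: complete_eq_closed)
  fix \<epsilon> :: real assume \<epsilon>: "\<epsilon> > 0"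
  \<comment> \<open>\<open>r\<close> may be zero or negative, and the radius is used as a
    divisor.\<close>
  define r' where "r' = max r 1"
  have r': "r' > 0" "r \<le> r'" by (auto simp: r'_def)
  have "\<epsilon> / 4 / r' > 0" using \<epsilon> r' by simp
  from suminf_exist_split[OF this b] obtain N
    where "norm (\<Sum>k. norm (b (k + N))) < \<epsilon> / 4 / r'" by blast
  then have "(\<Sum>k. norm (b (k + N))) < \<epsilon> / 4 / r'"
    by (simp only: real_norm_def abs_less_iff)
  then have N: "r' * (\<Sum>k. norm (b (k + N))) < \<epsilon> / 4"
    using r' by (simp add: field_simps)
  have bN: "summable (\<lambda>k. norm (b (k + N)))"
    using b by (rule summable_ignore_initial_segment)
  let ?C = "{\<Sum>k<N. c k *\<^sub>C b k | c. \<forall>k. cmod (c k) \<le> r'}"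
  obtain F where F: "finite F" "?C \<subseteq> (\<Union>x\<in>F. ball x (\<epsilon> / 4))"
    using compact_coefficient_sums[of N r', unfolded compact_eq_totally_bounded] \<epsilon>
    by (elim conjE allE[of _ "\<epsilon> / 4"]) auto
  \<comment> \<open>Closed balls are used because their finite union is closed and therefore also
    covers the closure of the image.\<close>
  have "?S \<subseteq> (\<Union>x\<in>F. cball x (\<epsilon> / 2))"
  proof clarify
    fix z :: 'a assume "z \<in> cball 0 r"
    then have z: "norm z \<le> r'" using r' by simp
    let ?f = "\<lambda>k. cinner z (v k) *\<^sub>C b k"
    have "cmod (cinner z (v k)) \<le> r'" for k
      using norm_cinner_le[of z "v k"] mult_left_mono[OF v1[of k], of "norm z"] z by simp
    then have "(\<Sum>k<N. ?f k) \<in> ?C" by auto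
    then obtain x where x: "x \<in> F" "dist x (\<Sum>k<N. ?f k) < \<epsilon> / 4"
      using F(2) by auto
    have "series_op v b z - (\<Sum>k<N. ?f k) = (\<Sum>k. ?f (k + N))"
      unfolding series_op_def by (simp add: suminf_minus_initial_segment[OF summable_series_op])
    also have "norm \<dots> \<le> (\<Sum>k. norm (?f (k + N)))"
      by (rule summable_norm) (rule summable_ignore_initial_segment[OF summable_norm_series_op])
    also have "\<dots> \<le> (\<Sum>k. r' * norm (b (k + N)))"
      using order_trans[OF norm_series_term_le mult_right_mono[OF z norm_ge_zero]]
      by (intro suminf_le summable_mult bN summable_ignore_initial_segment[OF summable_norm_series_op])
    also have "\<dots> < \<epsilon> / 4" using N by (simp add: suminf_mult[OF bN])
    finally have "dist (\<Sum>k<N. ?f k) (series_op v b z) < \<epsilon> / 4"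
      by (simp add: dist_norm norm_minus_commute)
    with x(2) have "dist x (series_op v b z) < \<epsilon> / 2"
      using dist_triangle[of x "series_op v b z" "\<Sum>k<N. ?f k"] by linarith
    then show "series_op v b z \<in> (\<Union>x\<in>F. cball x (\<epsilon> / 2))"
      using x(1) by (auto intro!: bexI[of _ x] less_imp_le)
  qed
  moreover have "closed (\<Union>x\<in>F. cball x (\<epsilon> / 2))"
    using F(1) by (intro closed_UN) auto
  ultimately have "closure ?S \<subseteq> (\<Union>x\<in>F. cball x (\<epsilon> / 2))"
    by (rule closure_minimal)
  also have "\<dots> \<subseteq> (\<Union>x\<in>F. ball x \<epsilon>)"
    using \<epsilon> by (intro UN_mono order_refl cball_subset_ball_iff[THEN iffD2]) auto
  finally show "\<exists>F. finite F \<and> closure ?S \<subseteq> (\<Union>x\<in>F. ball x \<epsilon>)"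
    using F(1) by blast
qed

end

section \<open>Closed spans and dimension\<close>

lemma csubspace_closure:
  fixes U :: "'a::complex_inner set"
  assumes U: "csubspace U"
  shows "csubspace (closure U)"
  unfolding complex_vector.subspace_def
proof (intro conjI ballI allI)
  show "0 \<in> closure U"
    using complex_vector.subspace_0[OF U] closure_subset by blast
next
  fix x y assume "x \<in> closure U" "y \<in> closure U"
  then obtain f g where "\<And>n. f n \<in> U" "f \<longlonglongrightarrow> x" "\<And>n. g n \<in> U" "g \<longlonglongrightarrow> y"
    unfolding closure_sequential by blast
  then show "x + y \<in> closure U"
    unfolding closure_sequential
    by (intro exI[of _ "\<lambda>n. f n + g n"]) (auto intro: tendsto_add complex_vector.subspace_add[OF U])
next
  fix c x assume "x \<in> closure U"
  then obtain f where "\<And>n. f n \<in> U" "f \<longlonglongrightarrow> x"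
    unfolding closure_sequential by blast
  then show "c *\<^sub>C x \<in> closure U"
    unfolding closure_sequential
    by (intro exI[of _ "\<lambda>n. c *\<^sub>C f n"])
       (auto intro: bounded_linear.tendsto[OF bounded_linear_scaleC_right] complex_vector.subspace_scale[OF U])
qed

lemmas csubspace_closed_cspan = csubspace_closure[OF complex_vector.subspace_span]

lemma closed_cspan_minimal:
  "A \<subseteq> U \<Longrightarrow> csubspace U \<Longrightarrow> closed U \<Longrightarrow> closure (cspan A) \<subseteq> (U::'a::complex_inner set)"
  by (intro closure_minimal complex_vector.span_minimal)

lemma mem_closed_cspan: "a \<in> A \<Longrightarrow> a \<in> closure (cspan (A::'a::complex_inner set))"
  using closure_subset complex_vector.span_base by blast

lemma csubspace_vimage:
  assumes A: "bounded_op UNIV UNIV A" and U: "csubspace U"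
  shows "csubspace {z. A z \<in> U}"
proof -
  interpret bounded_linear A using A by (rule bounded_op_UNIV_linear)
  show ?thesis
    using U unfolding complex_vector.subspace_def
    by (auto simp: zero add bounded_op_scaleC[OF A])
qed

lemma closed_vimage_op:
  assumes A: "bounded_op UNIV UNIV A" and U: "closed U"
  shows "closed {z. A z \<in> U}"
proof -
  interpret bounded_linear A using A by (rule bounded_op_UNIV_linear)
  show ?thesis
    using continuous_closed_vimage[OF U, of A] isCont[OF continuous_ident] by (simp add: vimage_def)
qed

text \<open>The preimage of \<open>U\<close> under \<open>A\<close> is a closed subspace, so it
  suffices that it contains the generators.\<close>

lemma op_maps_closed_cspan:
  assumes "bounded_op UNIV UNIV A" "csubspace U" "closed U" "\<And>k. A (f k) \<in> U"
  shows "z \<in> closure (cspan (range f)) \<Longrightarrow> A z \<in> U"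
  using closed_cspan_minimal[OF _ csubspace_vimage[OF assms(1,2)] closed_vimage_op[OF assms(1,3)], of "range f"]
    assms(4) by blast

lemma ops_agree_on_closed_cspan:
  assumes "bounded_op UNIV UNIV A" "bounded_op UNIV UNIV B" "\<And>k. A (f k) = B (f k)"
    and "z \<in> closure (cspan (range f))"
  shows "A z = B z"
  using op_maps_closed_cspan[OF bounded_op_diff[OF assms(1,2)], of "{0}" f z] assms(3,4)
  by (simp add: complex_vector.subspace_single_0)

lemma orthogonal_closed_cspan:
  "(\<And>k. cinner (f k) y = 0) \<Longrightarrow> z \<in> closure (cspan (range f)) \<Longrightarrow> cinner z y = 0"
  using closed_cspan_minimal[OF _ csubspace_cinner_eq_zero closed_cinner_eq_zero, of "range f" y] by blast

lemma mem_orth_compl_closed_cspan: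
  "(\<And>k. cinner y (f k) = 0) \<Longrightarrow> y \<in> orth_compl (closure (cspan (range f)))"
  unfolding orth_compl_def using orthogonal_closed_cspan[of f y] cinner_eq_zero_sym by blast

text \<open>A linear map takes a finite spanning set to a finite spanning set of the image, whereas
  an orthonormal sequence is linearly independent. The map \<open>L\<close> serves sets whose own
  vectors are orthonormal only after applying an operator.\<close>

lemma infinite_cdim_if_orthonormal_image:
  fixes f :: "nat \<Rightarrow> 'a::complex_inner"
  assumes L: "bounded_op UNIV UNIV L"
    and orth: "\<And>i j. cinner (f i) (f j) = (if i = j then 1 else 0)"
    and im: "\<And>k. \<exists>z\<in>U. f k = L z"
  shows "infinite_cdim U"
  unfolding infinite_cdim_def
proof
  assume "\<exists>B. finite B \<and> U \<subseteq> cspan B"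
  then obtain B where B: "finite B" "U \<subseteq> cspan B" by blast
  have sub: "cspan B \<subseteq> {z. L z \<in> cspan (L ` B)}"
    by (intro complex_vector.span_minimal csubspace_vimage L complex_vector.subspace_span)
       (auto intro: complex_vector.span_base)
  have "range f \<subseteq> cspan (L ` B)"
  proof (intro image_subsetI)
    fix k
    obtain z where "z \<in> U" "f k = L z" using im by blast
    then show "f k \<in> cspan (L ` B)" using B(2) sub by auto
  qed
  moreover have "\<not> cdependent (range f)"
    unfolding complex_vector.dependent_def
  proof clarify
    fix k assume "f k \<in> cspan (range f - {f k})"
    moreover have "cspan (range f - {f k}) \<subseteq> {z. cinner z (f k) = 0}"
      by (intro complex_vector.span_minimal csubspace_cinner_eq_zero) (auto simp: orth)
    ultimately have "cinner (f k) (f k) = 0" by blast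
    then show False by (simp only: orth) simp
  qed
  ultimately have "finite (range f)"
    using complex_vector.independent_span_bound[of "L ` B" "range f"] B(1) by blast
  moreover have "inj f"
    using orth by (metis injI zero_neq_one)
  ultimately show False
    using finite_imageD infinite_UNIV_nat by blast
qed

lemma cdim_one:
  assumes "d \<noteq> 0" "U \<subseteq> cspan {d}" "csubspace U" "u \<in> U" "u \<noteq> 0"
  shows "cdim U = 1"
proof (rule complex_vector.dim_unique)
  obtain k where k: "u = k *\<^sub>C d"
    using assms(2,4) by (auto simp: complex_vector.span_singleton)
  then have "k \<noteq> 0" using assms(5) by auto
  then have "d = inverse k *\<^sub>C u" by (simp add: k scaleC_scaleC scaleC_one)
  then show "{d} \<subseteq> U" using assms(3,4) complex_vector.subspace_scale by auto
qed (use assms in auto)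

lemma opnorm_le:
  assumes "csubspace U" "0 \<le> M" "\<And>y. y \<in> U \<Longrightarrow> norm (A y) \<le> M * norm y"
  shows "opnorm U A \<le> M"
  unfolding opnorm_def
proof (rule cSUP_least)
  show "{x \<in> U. norm x \<le> 1} \<noteq> {}"
    using complex_vector.subspace_0[OF assms(1)] by force
  fix y assume "y \<in> {x \<in> U. norm x \<le> 1}"
  then show "norm (A y) \<le> M"
    using assms(3)[of y] mult_left_mono[of "norm y" 1 M] assms(2) by auto
qed

section \<open>The block decomposition\<close>

text \<open>\<open>S\<close> straightens the \<open>x k\<close> into the orthonormal
  \<open>v k\<close>, and the \<open>w k\<close> are held back for the complement. The theorem uses
  two instances: the given operator with \<open>S\<close> inverse to an operator within 1/2 of the
  identity, whence the factor 2, and the conjugated operator with \<open>S = id\<close> and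
  \<open>x = v\<close>.\<close>

locale almost_eigenvectors =
  fixes T S :: "'a::chilbert_space \<Rightarrow> 'a" and x v w :: "nat \<Rightarrow> 'a" and e :: 'a
    and l :: complex and \<nu> :: "nat \<Rightarrow> complex" and \<alpha> :: "nat \<Rightarrow> real" and \<delta> :: real
  assumes T: "bounded_op UNIV UNIV T"
    and S: "bounded_op UNIV UNIV S" and S_le: "norm (S z) \<le> 2 * norm z"
    and vv: "cinner (v i) (v j) = (if i = j then 1 else 0)"
    and ww: "cinner (w i) (w j) = (if i = j then 1 else 0)"
    and wv: "cinner (w i) (v j) = 0"
    and ev: "cinner e (v j) = 0"
    and norm_e: "norm e = 1"
    and Sx: "S (x k) = v k" and Sw: "S (w k) = w k" and Se: "S e = e"
    and norm_x: "norm (x k) \<le> 1"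
    and Tx: "T (x k) = l *\<^sub>C x k + \<nu> k *\<^sub>C x k + \<alpha> k *\<^sub>R e"
    and \<nu>_le: "cmod (\<nu> k) \<le> \<delta> * (1/2)^k"
    and \<alpha>_pos: "0 < \<alpha> k" and \<alpha>_le: "\<alpha> k \<le> \<delta> * (1/2)^k"
begin

definition Y where "Y = closure (cspan (range x))"

lemma Y: "csubspace Y" "closed Y"
  by (auto simp: Y_def csubspace_closed_cspan)

lemma x_in_Y: "x k \<in> Y"
  unfolding Y_def by (rule mem_closed_cspan) simp

lemma \<delta>_nonneg: "0 \<le> \<delta>"
  using \<alpha>_pos[of 0] \<alpha>_le[of 0] by simp

lemma norm_v: "norm (v k) \<le> 1"
  using norm_eq_1_if_cinner_self[of "v k"] vv[of k k] by simp

definition Pe where "Pe = oproj Y e"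

text \<open>Both are defined on the whole space, so that boundedness can be handled globally; the
  matrix entries are their restrictions to \<open>Y\<close>.\<close>

definition K where "K y = oproj Y (T y) - l *\<^sub>C y"
definition F where "F y = T y - oproj Y (T y)"

text \<open>\<open>bK k\<close> and \<open>bF k\<close> are the values of \<open>K\<close> and
  \<open>F\<close> at \<open>x k\<close>: the vector
  \<open>\<nu> k *\<^sub>C x k + \<alpha> k *\<^sub>R e\<close> split along \<open>Y\<close> and its
  complement.\<close>

definition bK where "bK k = \<nu> k *\<^sub>C x k + \<alpha> k *\<^sub>R Pe"
definition bF where "bF k = \<alpha> k *\<^sub>R (e - Pe)"

lemma norm_Pe: "norm Pe \<le> 1"
  using norm_oproj_le[OF Y, of e] by (simp add: Pe_def norm_e)

lemma norm_bK: "norm (bK k) \<le> 2 * \<delta> * (1/2)^k"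
proof -
  have "cmod (\<nu> k) * norm (x k) \<le> (\<delta> * (1/2)^k) * 1"
    by (intro mult_mono \<nu>_le norm_x) (simp_all add: \<delta>_nonneg)
  moreover have "\<alpha> k * norm Pe \<le> (\<delta> * (1/2)^k) * 1"
    by (intro mult_mono \<alpha>_le norm_Pe) (simp_all add: \<delta>_nonneg)
  ultimately show ?thesis
    using norm_triangle_ineq[of "\<nu> k *\<^sub>C x k" "\<alpha> k *\<^sub>R Pe"] \<alpha>_pos[of k] by (simp add: bK_def)
qed

lemma norm_bF: "norm (bF k) \<le> 2 * \<delta> * (1/2)^k"
proof -
  have "norm (e - Pe) \<le> 2"
    using norm_triangle_ineq4[of e Pe] norm_e norm_Pe by simp
  then have "\<alpha> k * norm (e - Pe) \<le> (\<delta> * (1/2)^k) * 2"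
    by (intro mult_mono \<alpha>_le) (simp_all add: \<delta>_nonneg)
  then show ?thesis
    using \<alpha>_pos[of k] by (simp add: bF_def)
qed

lemmas summable_bK = geometric_half_bound(1)[OF norm_bK]
lemmas summable_bF = geometric_half_bound(1)[OF norm_bF]

lemma bounded_op_oproj_UNIV: "bounded_op UNIV UNIV (oproj Y)"
  using bounded_op_oproj[OF Y] by (auto simp: bounded_op_def)

lemma bounded_op_oproj_T: "bounded_op UNIV UNIV (\<lambda>y. oproj Y (T y))"
  by (rule bounded_op_comp[OF bounded_op_oproj_UNIV T])

lemma bounded_op_K: "bounded_op UNIV UNIV K"
  using bounded_op_diff[OF bounded_op_oproj_T bounded_op_scale[of l]] by (simp add: K_def[abs_def])

lemma bounded_op_F: "bounded_op UNIV UNIV F"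
  using bounded_op_diff[OF T bounded_op_oproj_T] by (simp add: F_def[abs_def])

lemma K_in_Y: "y \<in> Y \<Longrightarrow> K y \<in> Y"
  unfolding K_def
  by (intro complex_vector.subspace_diff complex_vector.subspace_scale Y oproj_mem)

lemma F_in_orth_compl: "F y \<in> orth_compl Y"
  unfolding F_def by (rule oproj_orth[OF Y])

lemma oproj_T_x: "oproj Y (T (x k)) = l *\<^sub>C x k + bK k"
  by (simp add: Tx bK_def oproj_add[OF Y] oproj_scaleC[OF Y] oproj_fixed[OF Y x_in_Y] scaleR_scaleC
      Pe_def add.assoc)

lemma K_x: "K (x k) = bK k"
  by (simp add: K_def oproj_T_x)

lemma F_x: "F (x k) = bF k"
  unfolding F_def oproj_T_x by (simp add: Tx bK_def bF_def scaleR_diff_right)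

text \<open>Both sides are bounded operators that agree at each \<open>x k\<close>, because
  \<open>S (x k) = v k\<close>. The series form supplies the norm bound and compactness.\<close>

lemma K_eq: "y \<in> Y \<Longrightarrow> K y = series_op v bK (S y)"
  unfolding Y_def
  by (rule ops_agree_on_closed_cspan[OF bounded_op_K
        bounded_op_comp[OF bounded_op_series_op[OF norm_v summable_bK] S]])
     (simp_all add: K_x Sx series_op_basis[OF norm_v summable_bK vv])

lemma F_eq: "y \<in> Y \<Longrightarrow> F y = series_op v bF (S y)"
  unfolding Y_def
  by (rule ops_agree_on_closed_cspan[OF bounded_op_F
        bounded_op_comp[OF bounded_op_series_op[OF norm_v summable_bF] S]])
     (simp_all add: F_x Sx series_op_basis[OF norm_v summable_bF vv])

lemma norm_series_op_S_le:
  assumes "\<And>k. norm (b k) \<le> 2 * \<delta> * (1/2)^k"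
  shows "norm (series_op v b (S y)) \<le> 8 * \<delta> * norm y"
proof -
  note g = geometric_half_bound[where b = b, OF assms]
  have "norm (series_op v b (S y)) \<le> (\<Sum>k. norm (b k)) * norm (S y)"
    by (rule norm_series_op_le[OF norm_v g(1)])
  \<comment> \<open>The final 8 is a product of three factors 2: from the bound on \<open>b\<close>,
    the geometric sum, and the bound on \<open>S\<close>.\<close>
  also have "\<dots> \<le> (2 * (2 * \<delta>)) * (2 * norm y)"
    by (intro mult_mono g(2) S_le) (simp_all add: \<delta>_nonneg)
  finally show ?thesis by simp
qed

lemma opnorm_K: "opnorm Y K \<le> 8 * \<delta>"
  by (rule opnorm_le[OF Y(1)]) (simp_all add: \<delta>_nonneg K_eq norm_series_op_S_le[OF norm_bK])

lemma opnorm_F: "opnorm Y F \<le> 8 * \<delta>"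
  by (rule opnorm_le[OF Y(1)]) (simp_all add: \<delta>_nonneg F_eq norm_series_op_S_le[OF norm_bF])

text \<open>\<open>S\<close> maps the unit ball of \<open>Y\<close> into the ball of radius 2, whose
  image under the series operator has compact closure.\<close>

lemma compact_op_K: "compact_op Y Y K"
  unfolding compact_op_def
proof
  show "bounded_op Y Y K" by (rule bounded_op_restrict[OF bounded_op_K K_in_Y])
  have "K ` {y \<in> Y. norm y \<le> 1} \<subseteq> series_op v bK ` cball 0 2"
  proof (intro image_subsetI)
    fix y assume "y \<in> {y \<in> Y. norm y \<le> 1}"
    then have "K y = series_op v bK (S y)" "norm (S y) \<le> 2"
      using K_eq S_le[of y] by auto
    then show "K y \<in> series_op v bK ` cball 0 2" by simp
  qed
  then have sub: "closure (K ` {y \<in> Y. norm y \<le> 1}) \<subseteq> closure (series_op v bK ` cball 0 2)"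
    by (rule closure_mono)
  have "compact (closure (series_op v bK ` cball 0 2) \<inter> closure (K ` {y \<in> Y. norm y \<le> 1}))"
    by (intro compact_Int_closed closed_closure compact_closure_series_op[OF norm_v summable_bK])
  then show "compact (closure (K ` {y \<in> Y. norm y \<le> 1}))"
    by (simp only: Int_absorb1[OF sub])
qed

text \<open>\<open>S\<close> maps \<open>Y\<close> into the orthogonal complement of
  \<open>e\<close>, because \<open>e\<close> is orthogonal to every \<open>v k\<close>. As
  \<open>S e = e\<close>, membership of \<open>e\<close> in \<open>Y\<close> would make
  \<open>e\<close> orthogonal to itself.\<close>

lemma e_not_Pe: "e - Pe \<noteq> 0"
proof
  assume "e - Pe = 0"
  then have "e \<in> Y" using oproj_mem[OF Y, of e] by (simp add: Pe_def)
  moreover have "S z \<in> {z. cinner z e = 0}" if "z \<in> Y" for z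
    using that unfolding Y_def
    by (rule op_maps_closed_cspan[OF S csubspace_cinner_eq_zero closed_cinner_eq_zero, rotated])
       (use ev cinner_eq_zero_sym in \<open>auto simp: Sx\<close>)
  ultimately have "cinner e e = 0" using Se by fastforce
  then show False using norm_e by auto
qed

text \<open>All \<open>bF k\<close> are multiples of the single vector \<open>e - Pe\<close>, so the
  series for \<open>F\<close> collapses to a scalar series times it. The value at \<open>x 0\<close>
  is nonzero.\<close>

lemma rank_one_op_F: "rank_one_op Y (orth_compl Y) F"
  unfolding rank_one_op_def
proof
  show "bounded_op Y (orth_compl Y) F"
    by (rule bounded_op_restrict[OF bounded_op_F F_in_orth_compl])
  have "F y \<in> cspan {e - Pe}" if "y \<in> Y" for y
  proof -
    \<comment> \<open>Geometric decay of the \<alpha> makes the scalar series summable, which allows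
      \<open>e - Pe\<close> to be pulled out of the sum.\<close>
    have le: "norm (cinner (S y) (v k) * \<alpha> k) \<le> norm (S y) * (\<delta> * (1/2)^k)" for k
    proof -
      have "cmod (cinner (S y) (v k)) \<le> norm (S y) * 1"
        using norm_cinner_le[of "S y" "v k"] mult_left_mono[OF norm_v[of k], of "norm (S y)"] by simp
      then show ?thesis
        unfolding norm_mult norm_of_real
        by (intro mult_mono) (use \<alpha>_le[of k] \<alpha>_pos[of k] in auto)
    qed
    have "summable (\<lambda>k. cinner (S y) (v k) * \<alpha> k)"
      by (rule summable_comparison_test'[of "\<lambda>k. norm (S y) * (\<delta> * (1/2)^k)" 0])
         (use le in \<open>auto intro!: summable_mult summable_geometric\<close>)
    from bounded_linear.suminf[OF bounded_linear_scaleC_left this]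
    have "(\<Sum>k. cinner (S y) (v k) * \<alpha> k) *\<^sub>C (e - Pe) = series_op v bF (S y)"
      by (simp add: series_op_def bF_def scaleR_scaleC scaleC_scaleC)
    then show ?thesis
      unfolding F_eq[OF that] by (metis complex_vector.span_base complex_vector.span_scale singletonI)
  qed
  moreover have "csubspace (F ` Y)"
    unfolding complex_vector.subspace_def
  proof (intro conjI ballI allI)
    interpret F: bounded_linear F using bounded_op_F by (rule bounded_op_UNIV_linear)
    show "0 \<in> F ` Y"
      using complex_vector.subspace_0[OF Y(1)] by (force simp: F.zero)
    show "a + b \<in> F ` Y" if "a \<in> F ` Y" "b \<in> F ` Y" for a b
      using that complex_vector.subspace_add[OF Y(1)] by (auto simp: F.add[symmetric])
    show "c *\<^sub>C a \<in> F ` Y" if "a \<in> F ` Y" for c a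
      using that complex_vector.subspace_scale[OF Y(1)]
      by (auto simp: bounded_op_scaleC[OF bounded_op_F, symmetric])
  qed
  moreover have "F (x 0) \<noteq> 0"
    using e_not_Pe \<alpha>_pos[of 0] by (simp add: F_x bF_def)
  ultimately show "cdim (F ` Y) = 1"
    using e_not_Pe x_in_Y[of 0] by (intro cdim_one[of "e - Pe" _ "F (x 0)"]) auto
qed

lemma infinite_cdim_Y: "infinite_cdim Y"
  by (rule infinite_cdim_if_orthonormal_image[OF S vv]) (use Sx x_in_Y in metis)

text \<open>Applying \<open>S\<close> and then the projection onto the complement of the \<open>v k\<close> annihilates \<open>Y\<close>
  and fixes the \<open>w k\<close>, so it maps the components of the \<open>w k\<close> orthogonal to \<open>Y\<close> back to the \<open>w k\<close>.\<close>

lemma infinite_cdim_orth_compl_Y: "infinite_cdim (orth_compl Y)"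
proof -
  define V where "V = closure (cspan (range v))"
  have V: "csubspace V" "closed V" by (auto simp: V_def csubspace_closed_cspan)
  have P: "bounded_op UNIV UNIV (oproj V)"
    using bounded_op_oproj[OF V] by (auto simp: bounded_op_def)
  have L: "bounded_op UNIV UNIV (\<lambda>z. S z - oproj V (S z))"
    by (rule bounded_op_diff[OF S bounded_op_comp[OF P S]])
  interpret L: bounded_linear "\<lambda>z. S z - oproj V (S z)" using L by (rule bounded_op_UNIV_linear)
  have SY: "S y \<in> V" if "y \<in> Y" for y
    using that unfolding Y_def
    by (rule op_maps_closed_cspan[OF S V, rotated]) (auto simp: Sx V_def intro: mem_closed_cspan)
  have "w k = S (w k - oproj Y (w k)) - oproj V (S (w k - oproj Y (w k)))" for k
  proof -
    have "S (oproj Y (w k)) \<in> V" by (intro SY oproj_mem Y)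
    moreover have "w k \<in> orth_compl V"
      unfolding V_def by (rule mem_orth_compl_closed_cspan[OF wv])
    ultimately show ?thesis
      unfolding L.diff by (simp add: Sw oproj_fixed[OF V] oproj_orth_compl[OF V])
  qed
  then show ?thesis
    by (intro infinite_cdim_if_orthonormal_image[OF L ww]) (use oproj_orth[OF Y] in metis)
qed

lemma block_matrix_KF:
  "block_matrix Y T (\<lambda>y. l *\<^sub>C y + K y) (\<lambda>z. oproj Y (T z)) F (\<lambda>z. T z - oproj Y (T z))"
  unfolding block_matrix_def
proof (intro conjI ballI)
  interpret T: bounded_linear T using T by (rule bounded_op_UNIV_linear)
  have lK: "l *\<^sub>C y + K y = oproj Y (T y)" for y by (simp add: K_def)
  show "bounded_op Y Y (\<lambda>y. l *\<^sub>C y + K y)"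
    unfolding lK by (rule bounded_op_restrict[OF bounded_op_oproj_T]) (rule oproj_mem[OF Y])
  show "bounded_op (orth_compl Y) Y (\<lambda>z. oproj Y (T z))"
    by (rule bounded_op_restrict[OF bounded_op_oproj_T]) (rule oproj_mem[OF Y])
  show "bounded_op Y (orth_compl Y) F"
    by (rule bounded_op_restrict[OF bounded_op_F F_in_orth_compl])
  show "bounded_op (orth_compl Y) (orth_compl Y) (\<lambda>z. T z - oproj Y (T z))"
    by (rule bounded_op_restrict[OF bounded_op_diff[OF T bounded_op_oproj_T]]) (rule oproj_orth[OF Y])
  show "T (y + z) = l *\<^sub>C y + K y + oproj Y (T z) + (F y + (T z - oproj Y (T z)))" for y z
    unfolding lK by (simp add: T.add F_def)
qed

text \<open>Here \<open>e\<close> is orthogonal to the generators of \<open>Y\<close>, so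
  \<open>Pe = 0\<close> and \<open>bK k\<close> reduces to
  \<open>\<nu> k *\<^sub>C v k\<close>.\<close>

lemma diagonal_op_K:
  assumes "\<And>k. x k = v k"
  shows "diagonal_op Y K"
proof -
  have "Pe = 0"
    unfolding Pe_def Y_def
    by (rule oproj_orth_compl[OF csubspace_closed_cspan closed_closure])
       (rule mem_orth_compl_closed_cspan, simp add: assms ev)
  then have "K (v k) = \<nu> k *\<^sub>C v k" for k
    using K_x[of k] by (simp add: bK_def assms)
  moreover have "orthonormal_basis_of Y (range v)"
  proof -
    have "x = v" using assms by auto
    moreover have "inj v" using vv by (metis injI zero_neq_one)
    ultimately show ?thesis
      unfolding orthonormal_basis_of_def Y_def by (auto simp: vv inj_eq)
  qed
  ultimately show ?thesis
    unfolding diagonal_op_def by blast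
qed

lemma block_decomposition:
  assumes "8 * \<delta> \<le> \<epsilon>"
  shows "orth_decomposition Y \<and> infinite_cdim Y \<and> infinite_cdim (orth_compl Y) \<and>
    block_matrix Y T (\<lambda>y. l *\<^sub>C y + K y) (\<lambda>z. oproj Y (T z)) F (\<lambda>z. T z - oproj Y (T z)) \<and>
    compact_op Y Y K \<and> rank_one_op Y (orth_compl Y) F \<and> opnorm Y K \<le> \<epsilon> \<and> opnorm Y F \<le> \<epsilon>"
  using orth_decompositionI[OF Y] infinite_cdim_Y infinite_cdim_orth_compl_Y block_matrix_KF
    compact_op_K rank_one_op_F opnorm_K opnorm_F assms by auto

end

section \<open>Extraction of an orthonormal sequence\<close>

text \<open>One Gram-Schmidt step: the projection \<open>p n\<close> of \<open>x n\<close> onto the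
  span of \<open>F\<close> tends to 0 by weak nullity, so removing it and normalizing changes
  \<open>x n\<close> little for large \<open>n\<close>. The predicate \<open>P\<close> carries
  further conditions that hold eventually.\<close>

lemma orthonormal_extension:
  fixes x :: "nat \<Rightarrow> 'a::complex_inner"
  assumes F: "finite F" "\<And>f. f \<in> F \<Longrightarrow> norm f = 1"
      "\<And>f g. f \<in> F \<Longrightarrow> g \<in> F \<Longrightarrow> f \<noteq> g \<Longrightarrow> cinner f g = 0"
    and x: "\<And>n. norm (x n) = 1" "\<And>v. (\<lambda>n. cinner (x n) v) \<longlonglongrightarrow> 0"
    and P: "\<forall>\<^sub>F n in sequentially. P n" and \<eta>: "\<eta> > 0"
  shows "\<exists>u n. norm u = 1 \<and> (\<forall>f\<in>F. cinner u f = 0) \<and> norm (u - x n) \<le> \<eta> \<and> P n"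
proof -
  define p where "p n = (\<Sum>f\<in>F. cinner (x n) f *\<^sub>C f)" for n
  have "(\<lambda>n. cinner (x n) f *\<^sub>C f) \<longlonglongrightarrow> 0" for f
    using bounded_linear.tendsto[OF bounded_linear_scaleC_left x(2), of f f] by simp
  then have "p \<longlonglongrightarrow> 0"
    unfolding p_def[abs_def] by (intro tendsto_null_sum) auto
  \<comment> \<open>One \<open>\<eta> / 2\<close> pays for subtracting \<open>p n\<close> and one
    for normalizing; the bound 1/2 keeps \<open>y\<close> away from 0.\<close>
  then have "\<forall>\<^sub>F n in sequentially. dist (p n) 0 < min (\<eta> / 2) (1 / 2)"
    using \<eta> by (intro tendstoD) auto
  with P have "\<forall>\<^sub>F n in sequentially. dist (p n) 0 < min (\<eta> / 2) (1 / 2) \<and> P n"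
    by eventually_elim simp
  then obtain n where n: "norm (p n) < \<eta> / 2" "norm (p n) < 1 / 2" "P n"
    by (auto simp: eventually_sequentially)
  define y where "y = x n - p n"
  have y: "\<bar>1 - norm y\<bar> \<le> norm (p n)"
    using norm_triangle_ineq3[of "x n" y] x(1)[of n] by (simp add: y_def)
  then have y0: "norm y > 0" using n(2) by linarith
  define u where "u = (1 / norm y) *\<^sub>R y"
  have "norm u = 1" using y0 by (simp add: u_def)
  moreover have "cinner u f = 0" if f: "f \<in> F" for f
  proof -
    have "cinner (p n) f = (\<Sum>g\<in>F. if g = f then cinner (x n) f else 0)"
      unfolding p_def cinner_sum_left
      by (rule sum.cong) (auto simp: cinner_scaleC_left F(2,3) f cinner_self)
    also have "\<dots> = cinner (x n) f" using F(1) f by simp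
    finally have "cinner y f = 0" by (simp add: y_def cinner_diff_left)
    then show ?thesis by (simp add: u_def scaleR_scaleC cinner_scaleC_left)
  qed
  moreover have "norm (u - x n) \<le> \<eta>"
  proof -
    have "u - y = (1 / norm y - 1) *\<^sub>R y" by (simp add: u_def scaleR_diff_left)
    then have "norm (u - y) = \<bar>1 / norm y - 1\<bar> * norm y" by simp
    also have "\<dots> = \<bar>(1 / norm y - 1) * norm y\<bar>" by (simp add: abs_mult)
    also have "\<dots> = \<bar>1 - norm y\<bar>" using y0 by (simp add: left_diff_distrib)
    finally have "norm (u - y) \<le> norm (p n)" using y by simp
    moreover have "norm (y - x n) = norm (p n)" by (simp add: y_def)
    ultimately show ?thesis
      using norm_triangle_ineq[of "u - y" "y - x n"] n(1) by simp
  qed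
  ultimately show ?thesis using n(3) by blast
qed

lemma orthonormal_sequence_near_weakly_null:
  fixes x :: "nat \<Rightarrow> 'a::complex_inner"
  assumes e: "norm e = 1"
    and x: "\<And>n. norm (x n) = 1" "\<And>v. (\<lambda>n. cinner (x n) v) \<longlonglongrightarrow> 0"
    and P: "\<And>k::nat. \<forall>\<^sub>F n in sequentially. P k n" and \<eta>: "\<And>k. \<eta> k > 0"
  shows "\<exists>u n. (\<forall>i j. cinner (u i) (u j) = (if i = j then 1 else 0)) \<and> (\<forall>k. cinner e (u k) = 0) \<and>
    (\<forall>k. norm (u k - x (n k)) \<le> \<eta> k) \<and> (\<forall>k. P k (n k))"
proof -
  \<comment> \<open>\<open>r\<close> pairs the vector and the index chosen at stage
    \<open>k\<close>, and \<open>f\<close> records the choices at earlier stages.\<close>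
  define Q where "Q f k r \<longleftrightarrow> norm (fst r) = 1 \<and> cinner (fst r) e = 0 \<and>
    (\<forall>j<k. cinner (fst r) (fst (f j)) = 0) \<and> norm (fst r - x (snd r)) \<le> \<eta> k \<and> P k (snd r)"
    for f :: "nat \<Rightarrow> 'a \<times> nat" and k r
  have "\<exists>f. \<forall>k. Q f k (f k)"
  proof (rule dependent_wellorder_choice)
    fix r and f g :: "nat \<Rightarrow> 'a \<times> nat" and k :: nat
    assume "\<And>j. j < k \<Longrightarrow> f j = g j"
    then show "Q f k r = Q g k r" by (simp add: Q_def)
  next
    fix k and f :: "nat \<Rightarrow> 'a \<times> nat"
    assume IH: "\<And>j. j < k \<Longrightarrow> Q f j (f j)"
    \<comment> \<open>Including \<open>e\<close> among the earlier vectors makes the new one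
      orthogonal to \<open>e\<close> as well.\<close>
    define F where "F = insert e ((\<lambda>j. fst (f j)) ` {..<k})"
    have orth: "cinner (fst (f i)) (fst (f j)) = 0" if "i < k" "j < k" "i \<noteq> j" for i j
      using IH[OF that(1)] IH[OF that(2)] that(3) unfolding Q_def
      by (metis cinner_eq_zero_sym linorder_neqE_nat)
    have e_orth: "cinner (fst (f i)) e = 0" "cinner e (fst (f i)) = 0" if "i < k" for i
      using IH[OF that] cinner_eq_zero_sym[of e] by (auto simp: Q_def)
    have "\<exists>u n. norm u = 1 \<and> (\<forall>f\<in>F. cinner u f = 0) \<and> norm (u - x n) \<le> \<eta> k \<and> P k n"
    proof (rule orthonormal_extension[OF _ _ _ x P \<eta>])
      show "finite F" by (simp add: F_def)
      show "norm g = 1" if "g \<in> F" for g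
        using that IH e by (auto simp: F_def Q_def)
      show "cinner g h = 0" if "g \<in> F" "h \<in> F" "g \<noteq> h" for g h
        using that orth e_orth unfolding F_def by fastforce
    qed
    then show "\<exists>r. Q f k r" by (auto simp: Q_def F_def)
  qed
  then obtain f where f: "\<And>k. Q f k (f k)" by blast
  have "cinner (fst (f i)) (fst (f j)) = (if i = j then 1 else 0)" for i j
  proof (cases "i = j")
    case True
    then show ?thesis using f[of i] by (simp add: Q_def cinner_self)
  next
    case False
    then show ?thesis
      using f[of i] f[of j] unfolding Q_def by (metis cinner_eq_zero_sym linorder_neqE_nat)
  qed
  moreover have "cinner e (fst (f k)) = 0" for k
    using f[of k] cinner_eq_zero_sym[of e] by (auto simp: Q_def)
  ultimately show ?thesis
    using f by (intro exI[of _ "\<lambda>k. fst (f k)"] exI[of _ "\<lambda>k. snd (f k)"]) (auto simp: Q_def)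
qed

section \<open>Assembly of the two decompositions\<close>

theorem theorem3p3:
  fixes T :: "'a::chilbert_space \<Rightarrow> 'a" and l :: complex
  assumes "bounded_op UNIV UNIV T"
    and "l \<in> frontier (op_spectrum T)"
    and "\<not> op_eigenvalue T l"
  shows "(\<forall>\<epsilon>::real. \<epsilon> > 0 \<longrightarrow>
      (\<exists>Y K B F D.
         orth_decomposition Y \<and> infinite_cdim Y \<and> infinite_cdim (orth_compl Y) \<and>
         block_matrix Y T (\<lambda>y. l *\<^sub>C y + K y) B F D \<and>
         compact_op Y Y K \<and> rank_one_op Y (orth_compl Y) F \<and>
         opnorm Y K \<le> \<epsilon> \<and> opnorm Y F \<le> \<epsilon>)) \<and>
    (\<forall>\<epsilon>::real. \<epsilon> > 0 \<longrightarrow>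
      (\<exists>S. invertible_op S \<and>
        (\<exists>Y K B F D.
           orth_decomposition Y \<and> infinite_cdim Y \<and> infinite_cdim (orth_compl Y) \<and>
           block_matrix Y (S \<circ> T \<circ> inv S) (\<lambda>y. l *\<^sub>C y + K y) B F D \<and>
           compact_op Y Y K \<and> rank_one_op Y (orth_compl Y) F \<and>
           opnorm Y K \<le> \<epsilon> \<and> opnorm Y F \<le> \<epsilon> \<and>
           diagonal_op Y K)))"
proof -
  note T = assms(1)
  obtain e x \<nu> \<alpha> where e: "norm e = 1" and x1: "\<And>n::nat. norm (x n) = 1"
    and \<alpha>_pos: "\<And>n. \<alpha> n > (0::real)"
    and Tx: "\<And>n. T (x n) = l *\<^sub>C x n + \<nu> n *\<^sub>C x n + \<alpha> n *\<^sub>R e"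
    and \<nu>0: "\<nu> \<longlonglongrightarrow> 0" and \<alpha>0: "\<alpha> \<longlonglongrightarrow> 0"
    using approximate_eigenvectors[OF assms(1,2)] by blast
  \<comment> \<open>\<open>T - l\<close> is injective because \<open>l\<close> is not an eigenvalue,
    and it sends \<open>x n\<close> to
    \<open>\<nu> n *\<^sub>C x n + \<alpha> n *\<^sub>R e\<close>, which tends to 0.\<close>
  have xweak: "(\<lambda>n. cinner (x n) y) \<longlonglongrightarrow> 0" for y
  proof (rule weakly_null[OF bounded_op_diff[OF T bounded_op_scale[of l]]])
    show "z = 0" if "T z - l *\<^sub>C z = 0" for z
      using that assms(3) by (auto simp: op_eigenvalue_def)
    have null: "(\<lambda>n. cmod (\<nu> n) + \<bar>\<alpha> n\<bar>) \<longlonglongrightarrow> 0"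
      using tendsto_add[OF tendsto_norm_zero[OF \<nu>0] tendsto_rabs_zero[OF \<alpha>0]] by simp
    have "norm (T (x n) - l *\<^sub>C x n) \<le> cmod (\<nu> n) + \<bar>\<alpha> n\<bar>" for n
      using norm_triangle_ineq[of "\<nu> n *\<^sub>C x n" "\<alpha> n *\<^sub>R e"] by (simp add: Tx x1 e add.assoc)
    then show "(\<lambda>n. T (x n) - l *\<^sub>C x n) \<longlonglongrightarrow> 0"
      by (intro Lim_null_comparison[OF _ null] always_eventually allI)
  qed (simp add: x1)

  \<comment> \<open>One construction serves both halves; the second also uses \<open>R\<close> as
    the inverse of the similarity \<open>S\<close>.\<close>
  have main: "\<exists>R S y v w \<nu>' \<alpha>'. bounded_op UNIV UNIV R \<and> bounded_op UNIV UNIV S \<and>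
      R \<circ> S = id \<and> S \<circ> R = id \<and> almost_eigenvectors T S y v w e l \<nu>' \<alpha>' \<delta>"
    if \<delta>: "\<delta> > 0" for \<delta>
  proof -
    define P where "P k n \<longleftrightarrow> cmod (\<nu> n) \<le> \<delta> * (1/2)^k \<and> \<alpha> n \<le> \<delta> * (1/2)^k" for k n :: nat
    have evP: "\<forall>\<^sub>F n in sequentially. P k n" for k
    proof -
      have pos: "\<delta> * (1/2)^k > 0" using \<delta> by simp
      show ?thesis
        using tendstoD[OF \<nu>0 pos] tendstoD[OF \<alpha>0 pos]
        unfolding P_def by eventually_elim auto
    qed
    \<comment> \<open>With the constant 1/4 the errors sum to at most 1/2. So \<open>G\<close> has
      norm at most 1/2, and \<open>R = I + G\<close> is invertible.\<close>
    have pos: "0 < 1/4 * (1/2::real)^k" for k :: nat by simp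
    obtain u n where uu: "\<And>i j. cinner (u i) (u j) = (if i = j then 1 else 0)"
      and eu: "\<And>k. cinner e (u k) = 0"
      and ux: "\<And>k. norm (u k - x (n k)) \<le> 1/4 * (1/2)^k" and Pn: "\<And>k. P k (n k)"
      using orthonormal_sequence_near_weakly_null
        [where P = P and \<eta> = "\<lambda>k. 1/4 * (1/2)^k", OF e x1 xweak evP pos] by blast
    define v where "v k = u (2 * k)" for k
    define w where "w k = u (2 * k + 1)" for k
    define y where "y k = x (n (2 * k))" for k
    define b where "b k = y k - v k" for k
    \<comment> \<open>Bounds obtained at index \<open>2 * k\<close> are weakened to the form indexed
      by \<open>k\<close> that the locale requires.\<close>
    have half: "(1/2::real)^(2 * k) \<le> (1/2)^k" for k
      by (intro power_decreasing) auto
    have vv: "cinner (v i) (v j) = (if i = j then 1 else 0)" for i j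
      by (simp add: v_def uu)
    have v1: "norm (v k) \<le> 1" for k
      using norm_eq_1_if_cinner_self[of "v k"] vv[of k k] by simp
    have b_le: "norm (b k) \<le> 1/4 * (1/2)^k" for k
      using order_trans[OF ux[of "2 * k"] mult_left_mono[OF half[of k]]]
      by (simp add: b_def y_def v_def norm_minus_commute)
    note b = geometric_half_bound[where b = b, OF b_le]
    have b_sum: "(\<Sum>k. norm (b k)) \<le> 1/2"
      using b(2) by simp
    define G where "G = series_op v b"
    define R where "R z = z + G z" for z
    have G: "bounded_op UNIV UNIV G"
      unfolding G_def by (rule bounded_op_series_op[OF v1 b(1)])
    have G_le: "norm (G z) \<le> 1/2 * norm z" for z
      using norm_series_op_le[where v = v, OF v1 b(1), of z] mult_right_mono[OF b_sum, of "norm z"] by (simp add: G_def)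
    have "invertible_op R"
      unfolding R_def[abs_def] by (rule invertible_op_ident_add[OF G _ G_le]) simp
    then obtain S where R: "bounded_op UNIV UNIV R" and S: "bounded_op UNIV UNIV S"
        and RS: "R \<circ> S = id" and SR: "S \<circ> R = id"
      by (auto simp: invertible_op_def)
    have SR': "S (R z) = z" and RS': "R (S z) = z" for z
      using SR RS by (auto simp: fun_eq_iff)
    have Rv: "R (v k) = y k" for k
    proof -
      have "G (v k) = b k"
        unfolding G_def by (rule series_op_basis[OF v1 b(1) vv])
      then show ?thesis by (simp add: R_def b_def)
    qed
    have R_fix: "R z = z" if "\<And>k. cinner z (v k) = 0" for z
    proof -
      have "G z = 0"
        unfolding G_def by (rule series_op_orthogonal[OF v1 b(1) that])
      then show ?thesis by (simp add: R_def)
    qed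
    \<comment> \<open>An odd index never equals an even one.\<close>
    have wv: "cinner (w i) (v j) = 0" for i j
      unfolding w_def v_def uu by (auto dest: arg_cong[of _ _ even])
    have ev: "cinner e (v j) = 0" for j by (simp add: v_def eu)
    have "almost_eigenvectors T S y v w e l (\<lambda>k. \<nu> (n (2 * k))) (\<lambda>k. \<alpha> (n (2 * k))) \<delta>"
    proof (unfold_locales; (rule T S vv wv ev e)?)
      \<comment> \<open>Since \<open>z = S z + G (S z)\<close> and \<open>G\<close> at most halves
        norms, \<open>norm z\<close> is at least half of \<open>norm (S z)\<close>.\<close>
      show "norm (S z) \<le> 2 * norm z" for z
        using norm_diff_ineq[of "S z" "G (S z)"] G_le[of "S z"] RS'[of z] by (simp add: R_def)
      show "cinner (w i) (w j) = (if i = j then 1 else 0)" for i j by (simp add: w_def uu)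
      show "S (y k) = v k" for k using SR'[of "v k"] by (simp add: Rv)
      show "S (w k) = w k" for k using SR'[of "w k"] by (simp add: R_fix wv)
      show "S e = e" using SR'[of e] by (simp add: R_fix ev)
      show "norm (y k) \<le> 1" for k by (simp add: y_def x1)
      show "T (y k) = l *\<^sub>C y k + \<nu> (n (2 * k)) *\<^sub>C y k + \<alpha> (n (2 * k)) *\<^sub>R e" for k
        by (simp add: y_def Tx)
      show "0 < \<alpha> (n (2 * k))" for k by (rule \<alpha>_pos)
      have "\<delta> * (1/2)^(2 * k) \<le> \<delta> * (1/2)^k" for k
        using mult_left_mono[OF half] \<delta> by simp
      then show "cmod (\<nu> (n (2 * k))) \<le> \<delta> * (1/2)^k" "\<alpha> (n (2 * k)) \<le> \<delta> * (1/2)^k" for k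
        using Pn[of "2 * k"] unfolding P_def by (blast intro: order_trans)+
    qed
    then show ?thesis using R S RS SR by blast
  qed

  show ?thesis
  proof (intro conjI allI impI)
    fix \<epsilon> :: real assume "\<epsilon> > 0"
    \<comment> \<open>\<open>\<epsilon> / 8\<close> compensates for the factor 8 in the operator
      norm bounds of the locale.\<close>
    then obtain S y v w \<nu>' \<alpha>' where "almost_eigenvectors T S y v w e l \<nu>' \<alpha>' (\<epsilon> / 8)"
      using main[of "\<epsilon> / 8"] by auto
    then interpret almost_eigenvectors T S y v w e l \<nu>' \<alpha>' "\<epsilon> / 8" .
    show "\<exists>Y K B F D.
         orth_decomposition Y \<and> infinite_cdim Y \<and> infinite_cdim (orth_compl Y) \<and>
         block_matrix Y T (\<lambda>y. l *\<^sub>C y + K y) B F D \<and>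
         compact_op Y Y K \<and> rank_one_op Y (orth_compl Y) F \<and>
         opnorm Y K \<le> \<epsilon> \<and> opnorm Y F \<le> \<epsilon>"
      using block_decomposition[of \<epsilon>] by (intro exI) simp
  next
    fix \<epsilon> :: real assume "\<epsilon> > 0"
    then obtain R S y v w \<nu>' \<alpha>' where R: "bounded_op UNIV UNIV R" and S: "bounded_op UNIV UNIV S"
      and RS: "R \<circ> S = id" and SR: "S \<circ> R = id"
      and ae: "almost_eigenvectors T S y v w e l \<nu>' \<alpha>' (\<epsilon> / 8)"
      using main[of "\<epsilon> / 8"] by auto
    interpret T: almost_eigenvectors T S y v w e l \<nu>' \<alpha>' "\<epsilon> / 8" by (rule ae)
    interpret S: bounded_linear S using S by (rule bounded_op_UNIV_linear)
    have inv: "inv S = R" by (rule inv_unique_comp[OF SR RS])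
    have Rv: "R (v k) = y k" for k
      using RS T.Sx[of k] by (metis comp_apply id_apply)
    \<comment> \<open>After conjugation the almost eigenvectors are the orthonormal
      \<open>v k\<close> themselves, so the identity takes the place of \<open>S\<close>.\<close>
    interpret C: almost_eigenvectors "S \<circ> T \<circ> inv S" id v v w e l \<nu>' \<alpha>' "\<epsilon> / 8"
    proof (unfold_locales; (rule T.vv T.ww T.wv T.ev T.norm_e T.norm_v T.\<nu>_le T.\<alpha>_pos T.\<alpha>_le)?)
      show "bounded_op UNIV UNIV (S \<circ> T \<circ> inv S)"
        using bounded_op_comp[OF S bounded_op_comp[OF T R]] by (simp add: inv comp_def)
      show "bounded_op UNIV UNIV (id :: 'a \<Rightarrow> 'a)"
        using bounded_op_ident by (simp add: id_def)
      \<comment> \<open>\<open>inv S\<close> sends \<open>v k\<close> to \<open>y k\<close>;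
        applying \<open>S\<close> to the formula for \<open>T (y k)\<close> turns \<open>y k\<close>
        back into \<open>v k\<close> and fixes \<open>e\<close>.\<close>
      show "(S \<circ> T \<circ> inv S) (v k) = l *\<^sub>C v k + \<nu>' k *\<^sub>C v k + \<alpha>' k *\<^sub>R e" for k
        by (simp add: inv Rv T.Tx S.add S.scaleR bounded_op_scaleC[OF S] T.Sx T.Se)
    qed simp_all
    have "invertible_op S"
      unfolding invertible_op_def using R S RS SR by blast
    then show "\<exists>S. invertible_op S \<and>
        (\<exists>Y K B F D.
           orth_decomposition Y \<and> infinite_cdim Y \<and> infinite_cdim (orth_compl Y) \<and>
           block_matrix Y (S \<circ> T \<circ> inv S) (\<lambda>y. l *\<^sub>C y + K y) B F D \<and>
           compact_op Y Y K \<and> rank_one_op Y (orth_compl Y) F \<and>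
           opnorm Y K \<le> \<epsilon> \<and> opnorm Y F \<le> \<epsilon> \<and>
           diagonal_op Y K)"
    proof (rule exI[of _ S, OF conjI])
      show "\<exists>Y K B F D.
           orth_decomposition Y \<and> infinite_cdim Y \<and> infinite_cdim (orth_compl Y) \<and>
           block_matrix Y (S \<circ> T \<circ> inv S) (\<lambda>y. l *\<^sub>C y + K y) B F D \<and>
           compact_op Y Y K \<and> rank_one_op Y (orth_compl Y) F \<and>
           opnorm Y K \<le> \<epsilon> \<and> opnorm Y F \<le> \<epsilon> \<and>
           diagonal_op Y K"
        using C.block_decomposition[of \<epsilon>] C.diagonal_op_K[OF refl]
        by (intro exI[of _ C.Y] exI[of _ C.K] exI[of _ "\<lambda>z. oproj C.Y ((S \<circ> T \<circ> inv S) z)"]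
            exI[of _ C.F] exI[of _ "\<lambda>z. (S \<circ> T \<circ> inv S) z - oproj C.Y ((S \<circ> T \<circ> inv S) z)"])
          simp
    qed
  qed
qed

end
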